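(* For each even integer $L\ge 2$ and each $A>0$, let $\lambda_{L,A}$ denote the principal eigenvalue of the problem $$-\Delta \varphi + A v\cdot\nabla\varphi=\lambda\varphi \text{ in } D,\qquad \varphi=0 \text{ on }\partial D,\qquad \varphi>0\text{ in } D,$$ where $D=[-L/2,L/2]\times[-L/2,L/2]$. Suppose $A\to\infty$ and $L=L(A)$ (an even integer) varies with $A$ in such a way that $$\liminf_{A\to\infty}\frac{\sqrt{A}}{L^2\log A\,\log L}>0 .$$ Then there exist constants $\lambda_0,\lambda_1$, independent of $L$ and $A$, such that $$0<\lambda_0\le \lambda_{L,A}\le \lambda_1<\infty$$ for all $A$ sufficiently large.
   Context: $H(x_1,x_2)=\frac{1}{\pi}\sin(\pi x_1)\sin(\pi x_2)$ and $v=(-\partial_{x_2}H,\partial_{x_1}H)$ is the associated (divergence-free, periodic) cellular flow. *)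

theory Defs
  imports "HOL-Analysis.Analysis"
begin

definition H :: "real \<Rightarrow> real \<Rightarrow> real" where
  "H x1 x2 = (1/pi) * sin (pi * x1) * sin (pi * x2)"

text \<open>Cellular flow v = (-d H/d x2, d H/d x1), written out explicitly.\<close>
definition v1 :: "real \<Rightarrow> real \<Rightarrow> real" where
  "v1 x1 x2 = - (sin (pi * x1) * cos (pi * x2))"

definition v2 :: "real \<Rightarrow> real \<Rightarrow> real" where
  "v2 x1 x2 = cos (pi * x1) * sin (pi * x2)"

definition sq_closed :: "real \<Rightarrow> (real \<times> real) set" where
  "sq_closed L = {p. \<bar>fst p\<bar> \<le> L/2 \<and> \<bar>snd p\<bar> \<le> L/2}"

definition sq_open :: "real \<Rightarrow> (real \<times> real) set" where
  "sq_open L = {p. \<bar>fst p\<bar> < L/2 \<and> \<bar>snd p\<bar> < L/2}"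

definition principal_eigenpair ::
  "real \<Rightarrow> real \<Rightarrow> real \<Rightarrow> (real \<times> real \<Rightarrow> real) \<Rightarrow> bool" where
  "principal_eigenpair L A lam \<phi> \<longleftrightarrow>
     continuous_on (sq_closed L) \<phi> \<and>
     (\<forall>p \<in> sq_closed L - sq_open L. \<phi> p = 0) \<and>
     (\<forall>p \<in> sq_open L. \<phi> p > 0) \<and>
     (\<exists>\<phi>1 \<phi>2 \<phi>11 \<phi>22 :: real \<times> real \<Rightarrow> real.
        continuous_on (sq_open L) \<phi>1 \<and> continuous_on (sq_open L) \<phi>2 \<and>
        continuous_on (sq_open L) \<phi>11 \<and> continuous_on (sq_open L) \<phi>22 \<and>
        (\<forall>(x, y) \<in> sq_open L.
           ((\<lambda>t. \<phi> (t, y)) has_real_derivative \<phi>1 (x, y)) (at x) \<and>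
           ((\<lambda>t. \<phi> (x, t)) has_real_derivative \<phi>2 (x, y)) (at y) \<and>
           ((\<lambda>t. \<phi>1 (t, y)) has_real_derivative \<phi>11 (x, y)) (at x) \<and>
           ((\<lambda>t. \<phi>2 (x, t)) has_real_derivative \<phi>22 (x, y)) (at y) \<and>
           - (\<phi>11 (x, y) + \<phi>22 (x, y))
             + A * (v1 x y * \<phi>1 (x, y) + v2 x y * \<phi>2 (x, y))
           = lam * \<phi> (x, y)))"

end

theory Submission
  imports Defs "HOL-Real_Asymp.Real_Asymp"
begin

text \<open>
  The upper bound needs no growth assumption: any function of \<open>H\<close> is transported by \<open>v\<close>, so
  touching a multiple of \<open>\<phi>\<close> from below, inside one cell, by the square of \<open>pi * H - 1/2\<close>
  eliminates the drift.

  For the lower bound let \<open>u\<close> be a barrier on one pair of columns \<open>\<bar>x\<bar> \<le> 1\<close>, that is,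
  \<open>0 \<le> u \<le> C\<close> and the generator of the diffusion applied to \<open>u\<close> is at most a negative constant,
  with \<open>u \<le> C * ln A / sqrt A\<close> on the separatrix \<open>x = 0\<close>. The flow is symmetric about every line
  \<open>x = k\<close> with \<open>k\<close> an integer, so the maxima of \<open>\<phi>\<close> on these lines are subharmonic on the
  integers up to an error of order \<open>lam * ln A / sqrt A\<close>. A discrete maximum principle over \<open>L\<close>
  lines gives \<open>max \<phi> \<le> const * lam * (1 + L\<^sup>2 * ln A / sqrt A) * max \<phi>\<close>.

  With \<open>a = A / pi\<close>, \<open>P = sin\<^sup>2 s\<close>, \<open>R = sin\<^sup>2 t\<close> in the angles \<open>s = pi * x\<close>, \<open>t = pi * y\<close>, the barrier is
  a sum of three explicit terms. A function like \<open>h * (3 - ln h)\<close> of \<open>h\<^sup>2 = P * R + 1 / a\<close> works inside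
  the cells, but fails by \<open>sqrt a * ln a * (P + R)\<close> in the boundary layer \<open>a * P * R = O(1)\<close>. This is
  compensated by a layer term that decreases along the three separatrices which are not crossed
  and uses absorption on \<open>\<bar>s\<bar> = pi\<close>. A logarithmic term handles the stagnation points, where
  \<open>P + R\<close> vanishes.
\<close>

section \<open>The generator in angular coordinates\<close>

text \<open>\<open>jet a f f1 f2 g\<close>: \<open>f1\<close>, \<open>f2\<close> are the partial derivatives of \<open>f\<close>, and \<open>g\<close> is the image of \<open>f\<close>
  under \<open>(\<Delta> + A * v \<cdot> \<nabla>) / pi\<^sup>2\<close> written in the angles, with \<open>a = A / pi\<close>. The adverse sign of
  the drift is undone later by shifting \<open>y\<close> by one cell.\<close>

definition jet :: "real \<Rightarrow> (real \<Rightarrow> real \<Rightarrow> real) \<Rightarrow> (real \<Rightarrow> real \<Rightarrow> real) \<Rightarrow> (real \<Rightarrow> real \<Rightarrow> real) \<Rightarrow> (real \<Rightarrow> real \<Rightarrow> real) \<Rightarrow> bool" where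
  "jet a f f1 f2 g \<longleftrightarrow> continuous_on UNIV (\<lambda>p. f (fst p) (snd p)) \<and>
     (\<exists>f11 f22. \<forall>s t.
        ((\<lambda>s. f s t) has_real_derivative f1 s t) (at s) \<and>
        ((\<lambda>t. f s t) has_real_derivative f2 s t) (at t) \<and>
        ((\<lambda>s. f1 s t) has_real_derivative f11 s t) (at s) \<and>
        ((\<lambda>t. f2 s t) has_real_derivative f22 s t) (at t) \<and>
        g s t = f11 s t + f22 s t + a * (cos s * sin t * f2 s t - sin s * cos t * f1 s t))"

lemma jetI:
  assumes "continuous_on UNIV (\<lambda>p. f (fst p) (snd p))"
    and "\<And>s t. ((\<lambda>s. f s t) has_real_derivative f1 s t) (at s)"
    and "\<And>s t. ((\<lambda>t. f s t) has_real_derivative f2 s t) (at t)"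
    and "\<And>s t. ((\<lambda>s. f1 s t) has_real_derivative f11 s t) (at s)"
    and "\<And>s t. ((\<lambda>t. f2 s t) has_real_derivative f22 s t) (at t)"
    and "\<And>s t. g s t = f11 s t + f22 s t + a * (cos s * sin t * f2 s t - sin s * cos t * f1 s t)"
  shows "jet a f f1 f2 g"
  unfolding jet_def using assms by blast

section \<open>Sum, product and chain rules for the generator\<close>

lemma jet_cong:
  assumes "jet a f f1 f2 f3"
    and "\<And>s t. g s t = f s t" "\<And>s t. g1 s t = f1 s t" "\<And>s t. g2 s t = f2 s t" "\<And>s t. g3 s t = f3 s t"
  shows "jet a g g1 g2 g3"
proof -
  have "g = f" "g1 = f1" "g2 = f2" "g3 = f3" using assms(2-5) by blast+
  with assms(1) show ?thesis by simp
qed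

lemma jet_const: "jet a (\<lambda>s t. c) (\<lambda>s t. 0) (\<lambda>s t. 0) (\<lambda>s t. 0)"
  by (rule jetI[where ?f11.0 = "\<lambda>s t. 0" and ?f22.0 = "\<lambda>s t. 0"]) auto

lemma jet_add:
  assumes "jet a f f1 f2 f3" "jet a g g1 g2 g3"
  shows "jet a (\<lambda>s t. f s t + g s t) (\<lambda>s t. f1 s t + g1 s t) (\<lambda>s t. f2 s t + g2 s t)
           (\<lambda>s t. f3 s t + g3 s t)"
proof -
  obtain f11 f22 g11 g22 where
    f: "\<And>s t. ((\<lambda>s. f s t) has_real_derivative f1 s t) (at s) \<and>
        ((\<lambda>t. f s t) has_real_derivative f2 s t) (at t) \<and>
        ((\<lambda>s. f1 s t) has_real_derivative f11 s t) (at s) \<and>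
        ((\<lambda>t. f2 s t) has_real_derivative f22 s t) (at t) \<and>
        f3 s t = f11 s t + f22 s t + a * (cos s * sin t * f2 s t - sin s * cos t * f1 s t)" and
    g: "\<And>s t. ((\<lambda>s. g s t) has_real_derivative g1 s t) (at s) \<and>
        ((\<lambda>t. g s t) has_real_derivative g2 s t) (at t) \<and>
        ((\<lambda>s. g1 s t) has_real_derivative g11 s t) (at s) \<and>
        ((\<lambda>t. g2 s t) has_real_derivative g22 s t) (at t) \<and>
        g3 s t = g11 s t + g22 s t + a * (cos s * sin t * g2 s t - sin s * cos t * g1 s t)"
    using assms unfolding jet_def by blast
  have "continuous_on UNIV (\<lambda>p. f (fst p) (snd p) + g (fst p) (snd p))"
    using assms unfolding jet_def by (intro continuous_intros) auto
  then show ?thesis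
  proof (rule jetI[where ?f11.0 = "\<lambda>s t. f11 s t + g11 s t" and ?f22.0 = "\<lambda>s t. f22 s t + g22 s t"], goal_cases)
    case (5 s t)
    have f': "f3 s t = f11 s t + f22 s t + a * (cos s * sin t * f2 s t - sin s * cos t * f1 s t)"
      and g': "g3 s t = g11 s t + g22 s t + a * (cos s * sin t * g2 s t - sin s * cos t * g1 s t)"
      using f g by blast+
    show ?case unfolding f' g' by (simp add: algebra_simps)
  qed (use f g in \<open>auto intro!: derivative_intros\<close>)
qed

text \<open>The drift is a derivation, so only the Laplacian leaves a product of gradients
  behind.\<close>

lemma jet_mult:
  assumes "jet a f f1 f2 f3" "jet a g g1 g2 g3"
  shows "jet a (\<lambda>s t. f s t * g s t) (\<lambda>s t. f1 s t * g s t + f s t * g1 s t)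
           (\<lambda>s t. f2 s t * g s t + f s t * g2 s t)
           (\<lambda>s t. f s t * g3 s t + g s t * f3 s t + 2 * (f1 s t * g1 s t + f2 s t * g2 s t))"
proof -
  obtain f11 f22 g11 g22 where
    f: "\<And>s t. ((\<lambda>s. f s t) has_real_derivative f1 s t) (at s) \<and>
        ((\<lambda>t. f s t) has_real_derivative f2 s t) (at t) \<and>
        ((\<lambda>s. f1 s t) has_real_derivative f11 s t) (at s) \<and>
        ((\<lambda>t. f2 s t) has_real_derivative f22 s t) (at t) \<and>
        f3 s t = f11 s t + f22 s t + a * (cos s * sin t * f2 s t - sin s * cos t * f1 s t)" and
    g: "\<And>s t. ((\<lambda>s. g s t) has_real_derivative g1 s t) (at s) \<and>
        ((\<lambda>t. g s t) has_real_derivative g2 s t) (at t) \<and>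
        ((\<lambda>s. g1 s t) has_real_derivative g11 s t) (at s) \<and>
        ((\<lambda>t. g2 s t) has_real_derivative g22 s t) (at t) \<and>
        g3 s t = g11 s t + g22 s t + a * (cos s * sin t * g2 s t - sin s * cos t * g1 s t)"
    using assms unfolding jet_def by blast
  have "continuous_on UNIV (\<lambda>p. f (fst p) (snd p) * g (fst p) (snd p))"
    using assms unfolding jet_def by (intro continuous_intros) auto
  then show ?thesis
  proof (rule jetI[where ?f11.0 = "\<lambda>s t. f11 s t * g s t + 2 * f1 s t * g1 s t + f s t * g11 s t"
          and ?f22.0 = "\<lambda>s t. f22 s t * g s t + 2 * f2 s t * g2 s t + f s t * g22 s t"], goal_cases)
    case (5 s t)
    have f': "f3 s t = f11 s t + f22 s t + a * (cos s * sin t * f2 s t - sin s * cos t * f1 s t)"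
      and g': "g3 s t = g11 s t + g22 s t + a * (cos s * sin t * g2 s t - sin s * cos t * g1 s t)"
      using f g by blast+
    show ?case unfolding f' g' by (simp add: algebra_simps)
  qed (use f g in \<open>auto intro!: derivative_eq_intros simp: algebra_simps\<close>)
qed

lemma jet_cmult:
  assumes "jet a f f1 f2 f3"
  shows "jet a (\<lambda>s t. c * f s t) (\<lambda>s t. c * f1 s t) (\<lambda>s t. c * f2 s t) (\<lambda>s t. c * f3 s t)"
  using jet_mult[OF jet_const[of a c] assms] by simp

lemma jet_comp:
  assumes "jet a f f1 f2 f3"
    and h: "\<And>s t. (h has_real_derivative h1 (f s t)) (at (f s t))"
    and h1: "\<And>s t. (h1 has_real_derivative h2 (f s t)) (at (f s t))"
  shows "jet a (\<lambda>s t. h (f s t)) (\<lambda>s t. h1 (f s t) * f1 s t) (\<lambda>s t. h1 (f s t) * f2 s t)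
           (\<lambda>s t. h1 (f s t) * f3 s t + h2 (f s t) * ((f1 s t)\<^sup>2 + (f2 s t)\<^sup>2))"
proof -
  obtain f11 f22 where
    f: "\<And>s t. ((\<lambda>s. f s t) has_real_derivative f1 s t) (at s) \<and>
        ((\<lambda>t. f s t) has_real_derivative f2 s t) (at t) \<and>
        ((\<lambda>s. f1 s t) has_real_derivative f11 s t) (at s) \<and>
        ((\<lambda>t. f2 s t) has_real_derivative f22 s t) (at t) \<and>
        f3 s t = f11 s t + f22 s t + a * (cos s * sin t * f2 s t - sin s * cos t * f1 s t)"
    using assms(1) unfolding jet_def by blast
  \<comment> \<open>Joint continuity has to be carried along separately, since the existence of
    partial derivatives does not give it.\<close>
  have fc: "isCont (\<lambda>p. f (fst p) (snd p)) p" for p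
    using assms(1) unfolding jet_def by (meson UNIV_I continuous_on_eq_continuous_at open_UNIV)
  have "isCont (\<lambda>p. h (f (fst p) (snd p))) p" for p
    using isCont_o2[OF fc[of p] DERIV_isCont[OF h]] by simp
  then have "continuous_on UNIV (\<lambda>p. h (f (fst p) (snd p)))"
    by (simp add: continuous_on_eq_continuous_at)
  then show ?thesis
  proof (rule jetI[where ?f11.0 = "\<lambda>s t. h1 (f s t) * f11 s t + h2 (f s t) * (f1 s t)\<^sup>2"
          and ?f22.0 = "\<lambda>s t. h1 (f s t) * f22 s t + h2 (f s t) * (f2 s t)\<^sup>2"], goal_cases)
    case (1 s t) show ?case
      using DERIV_chain2[of h "h1 (f s t)" "\<lambda>s. f s t" s "f1 s t" UNIV] h f by blast
  next
    case (2 s t) show ?case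
      using DERIV_chain2[of h "h1 (f s t)" "\<lambda>t. f s t" t "f2 s t" UNIV] h f by blast
  next
    case (3 s t)
    have "((\<lambda>s. h1 (f s t)) has_real_derivative h2 (f s t) * f1 s t) (at s)"
      using DERIV_chain2[of h1 "h2 (f s t)" "\<lambda>s. f s t" s "f1 s t" UNIV] h1 f by blast
    from DERIV_mult[OF this, of "\<lambda>s. f1 s t" "f11 s t"] f show ?case
      by (simp add: power2_eq_square algebra_simps)
  next
    case (4 s t)
    have "((\<lambda>t. h1 (f s t)) has_real_derivative h2 (f s t) * f2 s t) (at t)"
      using DERIV_chain2[of h1 "h2 (f s t)" "\<lambda>t. f s t" t "f2 s t" UNIV] h1 f by blast
    from DERIV_mult[OF this, of "\<lambda>t. f2 s t" "f22 s t"] f show ?case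
      by (simp add: power2_eq_square algebra_simps)
  next
    case (5 s t)
    have *: "f3 s t = f11 s t + f22 s t + a * (cos s * sin t * f2 s t - sin s * cos t * f1 s t)"
      using f by blast
    show ?case unfolding * by (simp add: algebra_simps)
  qed
qed

section \<open>The trigonometric building blocks of the barrier\<close>

lemma jet_sin_sq_fst: "jet a (\<lambda>s t. (sin s)\<^sup>2) (\<lambda>s t. 2 * sin s * cos s) (\<lambda>s t. 0)
   (\<lambda>s t. 2 - 4 * (sin s)\<^sup>2 - 2 * a * cos s * cos t * (sin s)\<^sup>2)"
proof (rule jetI[where ?f11.0 = "\<lambda>s t. 2 * (cos s)\<^sup>2 - 2 * (sin s)\<^sup>2" and ?f22.0 = "\<lambda>s t. 0"], goal_cases)
  case (6 s t)
  show ?case unfolding cos_squared_eq by (simp add: power2_eq_square algebra_simps)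
qed (auto intro!: derivative_eq_intros continuous_intros simp: power2_eq_square algebra_simps)

lemma jet_sin_sq_snd: "jet a (\<lambda>s t. (sin t)\<^sup>2) (\<lambda>s t. 0) (\<lambda>s t. 2 * sin t * cos t)
   (\<lambda>s t. 2 - 4 * (sin t)\<^sup>2 + 2 * a * cos s * cos t * (sin t)\<^sup>2)"
proof (rule jetI[where ?f22.0 = "\<lambda>s t. 2 * (cos t)\<^sup>2 - 2 * (sin t)\<^sup>2" and ?f11.0 = "\<lambda>s t. 0"], goal_cases)
  case (6 s t)
  show ?case unfolding cos_squared_eq by (simp add: power2_eq_square algebra_simps)
qed (auto intro!: derivative_eq_intros continuous_intros simp: power2_eq_square algebra_simps)

text \<open>The product is the square of \<open>pi * H\<close>, a first integral of the flow: the
  two drift terms cancel, and \<open>a\<close> disappears from the result.\<close>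

lemma jet_sin_sq_prod: "jet a (\<lambda>s t. (sin s)\<^sup>2 * (sin t)\<^sup>2) (\<lambda>s t. 2 * sin s * cos s * (sin t)\<^sup>2)
   (\<lambda>s t. 2 * sin t * cos t * (sin s)\<^sup>2)
   (\<lambda>s t. 2 * ((sin s)\<^sup>2 + (sin t)\<^sup>2) - 8 * ((sin s)\<^sup>2 * (sin t)\<^sup>2))"
  using jet_mult[OF jet_sin_sq_fst[of a] jet_sin_sq_snd[of a]] by (simp add: algebra_simps)

text \<open>At the stagnation points with \<open>sin s = sin t = 0\<close> this product is 1 or -1.
  The value 1 marks those at which the drift contracts \<open>s\<close> and expands
  \<open>t\<close>, the value -1 those at which it does the reverse. The weights of the logarithmic
  corner term are built from it.\<close>

lemma jet_cos_prod: "jet a (\<lambda>s t. cos s * cos t) (\<lambda>s t. - sin s * cos t) (\<lambda>s t. - cos s * sin t)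
   (\<lambda>s t. - 2 * cos s * cos t + a * ((sin s)\<^sup>2 - (sin t)\<^sup>2))"
proof (rule jetI[where ?f11.0 = "\<lambda>s t. - cos s * cos t" and ?f22.0 = "\<lambda>s t. - cos s * cos t"], goal_cases)
  case (6 s t)
  have "cos s * sin t * (- cos s * sin t) - sin s * cos t * (- sin s * cos t)
     = (sin s)\<^sup>2 * (cos t)\<^sup>2 - (cos s)\<^sup>2 * (sin t)\<^sup>2" by (simp add: power2_eq_square)
  also have "\<dots> = (sin s)\<^sup>2 - (sin t)\<^sup>2" unfolding cos_squared_eq by (simp add: algebra_simps)
  finally show ?case by (simp only:)
qed (auto intro!: derivative_eq_intros continuous_intros)

text \<open>On \<open>cos s = -1\<close> this function increases along the flow, but only away from the corners;
  on the other three sides it decreases. The term \<open>(1 - cos s) * cos t * (sin t)\<^sup>2\<close>, without which the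
  function is linear on the sides, provides the decrease near the two corners on \<open>cos s = -1\<close>.\<close>

lemma jet_side_coordinate: "jet a (\<lambda>s t. 2 * cos t - cos s * cos t + (1 - cos s) * cos t * (sin t)\<^sup>2)
   (\<lambda>s t. sin s * cos t * (1 + (sin t)\<^sup>2))
   (\<lambda>s t. sin t * (-2 + cos s + (1 - cos s) * (2 - 3 * (sin t)\<^sup>2)))
   (\<lambda>s t. cos s * cos t * (1 + (sin t)\<^sup>2) + cos t * (-2 + cos s + (1 - cos s) * (2 - 9 * (sin t)\<^sup>2))
     - a * ((sin s)\<^sup>2 + (sin t)\<^sup>2 + 3 * cos s * (1 - cos s) * ((sin t)\<^sup>2)\<^sup>2
         - (sin s)\<^sup>2 * (sin t)\<^sup>2 * (1 + (sin t)\<^sup>2)))"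
proof (rule jetI[where ?f11.0 = "\<lambda>s t. cos s * cos t * (1 + (sin t)\<^sup>2)"
       and ?f22.0 = "\<lambda>s t. cos t * (-2 + cos s + (1 - cos s) * (2 - 9 * (sin t)\<^sup>2))"], goal_cases)
  case (3 s t)
  have "((\<lambda>t. 2 * cos t - cos s * cos t + (1 - cos s) * cos t * (sin t)\<^sup>2) has_real_derivative
     - 2 * sin t + cos s * sin t + (1 - cos s) * (2 * sin t * (cos t)\<^sup>2 - sin t * (sin t)\<^sup>2)) (at t)"
    by (auto intro!: derivative_eq_intros simp: power2_eq_square algebra_simps)
  then show ?case unfolding cos_squared_eq by (simp add: algebra_simps)
next
  case (5 s t)
  have "((\<lambda>t. sin t * (-2 + cos s + (1 - cos s) * (2 - 3 * (sin t)\<^sup>2))) has_real_derivative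
     cos t * (-2 + cos s + (1 - cos s) * (2 - 3 * (sin t)\<^sup>2)) + sin t * ((1 - cos s) * (- 6 * sin t * cos t))) (at t)"
    by (auto intro!: derivative_eq_intros simp: algebra_simps)
  then show ?case by (simp add: power2_eq_square algebra_simps)
next
  case (6 s t)
  have "cos s * sin t * (sin t * (-2 + cos s + (1 - cos s) * (2 - 3 * (sin t)\<^sup>2)))
        - sin s * cos t * (sin s * cos t * (1 + (sin t)\<^sup>2))
     = (sin t)\<^sup>2 * (- (cos s)\<^sup>2 - 3 * cos s * (1 - cos s) * (sin t)\<^sup>2) - (sin s)\<^sup>2 * (cos t)\<^sup>2 * (1 + (sin t)\<^sup>2)"
    by (simp add: power2_eq_square algebra_simps)
  also have "\<dots> = - ((sin s)\<^sup>2 + (sin t)\<^sup>2 + 3 * cos s * (1 - cos s) * ((sin t)\<^sup>2)\<^sup>2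
         - (sin s)\<^sup>2 * (sin t)\<^sup>2 * (1 + (sin t)\<^sup>2))"
    unfolding cos_squared_eq by (simp add: power2_eq_square algebra_simps cos_squared_eq[unfolded power2_eq_square])
  finally show ?case by (simp only:)
qed (auto intro!: derivative_eq_intros continuous_intros simp: algebra_simps power2_eq_square)

text \<open>For \<open>\<bar>s\<bar> \<le> pi\<close>, \<open>cos (s / 2)\<close> measures the
  distance to the line \<open>\<bar>s\<bar> = pi\<close>, where it vanishes linearly. With
  \<open>k = sqrt a\<close> the function is positive only in a strip of width of order
  \<open>1 / sqrt a\<close> along this line, and \<open>(sin t)\<^sup>2 / 4\<close> closes the strip
  at the corners.\<close>

lemma jet_edge_distance: "jet a (\<lambda>s t. (sin t)\<^sup>2 / 4 - k * cos (s / 2)) (\<lambda>s t. k * sin (s / 2) / 2)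
   (\<lambda>s t. sin t * cos t / 2)
   (\<lambda>s t. (2 - 4 * (sin t)\<^sup>2 + 2 * a * cos s * cos t * (sin t)\<^sup>2) / 4
      + k * cos (s / 2) * (1/4 - a * cos t * (sin (s / 2))\<^sup>2))"
proof -
  \<comment> \<open>The half-angle form extracts a factor \<open>cos (s / 2)\<close> from the drift.
    Where the function is positive, \<open>k * cos (s / 2)\<close> is bounded, so with
    \<open>k = sqrt a\<close> the drift there has order \<open>a\<close> and not
    \<open>a * sqrt a\<close>.\<close>
  have s: "sin s = 2 * sin (s/2) * cos (s/2)" for s :: real
    using sin_double[of "s/2"] by simp
  have "jet a (\<lambda>s t. cos (s/2)) (\<lambda>s t. - sin (s/2) / 2) (\<lambda>s t. 0)
     (\<lambda>s t. - cos (s/2) / 4 + a * cos t * (sin (s/2))\<^sup>2 * cos (s/2))"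
  proof (rule jetI[where ?f11.0 = "\<lambda>s t. - cos (s/2) / 4" and ?f22.0 = "\<lambda>s t. 0"], goal_cases)
    case (6 s t)
    show ?case by (subst s[of s]) (simp add: power2_eq_square algebra_simps)
  qed (auto intro!: derivative_eq_intros continuous_intros)
  from jet_add[OF jet_cmult[OF jet_sin_sq_snd, of _ "1/4"] jet_cmult[OF this, of "-k"]]
  show ?thesis by (rule jet_cong) (simp_all add: field_simps)
qed

text \<open>The cube is the lowest integer power of the positive part that is twice differentiable
  at 0, as \<open>jet\<close> demands.\<close>

lemma DERIV_pos_cube:
  "((\<lambda>x::real. (max 0 x) ^ 3) has_real_derivative 3 * (max 0 x)\<^sup>2) (at x)"
  "((\<lambda>x::real. 3 * (max 0 x)\<^sup>2) has_real_derivative 6 * max 0 x) (at x)"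
proof -
  consider "x < 0" | "x = 0" | "x > 0" by linarith
  then show "((\<lambda>x::real. (max 0 x) ^ 3) has_real_derivative 3 * (max 0 x)\<^sup>2) (at x)"
  proof cases
    case 1
    show ?thesis
      by (rule has_field_derivative_transform_within_open[of "\<lambda>x. 0" _ _ "{..<0}"]) (use 1 in auto)
  next
    case 2
    have "((\<lambda>h::real. (max 0 h) ^ 3 / h) \<longlongrightarrow> 0) (at 0)"
    proof (rule Lim_null_comparison[where g = "\<lambda>h. h\<^sup>2"])
      show "\<forall>\<^sub>F h::real in at 0. norm ((max 0 h) ^ 3 / h) \<le> h\<^sup>2"
        by (rule always_eventually) (auto simp: max_def power2_eq_square power3_eq_cube abs_if)
      show "((\<lambda>h::real. h\<^sup>2) \<longlongrightarrow> 0) (at 0)" by (auto intro!: tendsto_eq_intros)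
    qed
    then show ?thesis using 2 by (simp add: DERIV_def)
  next
    case 3
    show ?thesis
      by (rule has_field_derivative_transform_within_open[of "\<lambda>x. x ^ 3" _ _ "{0<..}"])
         (use 3 in \<open>auto intro!: derivative_eq_intros\<close>)
  qed
  consider "x < 0" | "x = 0" | "x > 0" by linarith
  then show "((\<lambda>x::real. 3 * (max 0 x)\<^sup>2) has_real_derivative 6 * max 0 x) (at x)"
  proof cases
    case 1
    show ?thesis
      by (rule has_field_derivative_transform_within_open[of "\<lambda>x. 0" _ _ "{..<0}"]) (use 1 in auto)
  next
    case 2
    have "((\<lambda>h::real. 3 * (max 0 h)\<^sup>2 / h) \<longlongrightarrow> 0) (at 0)"
    proof (rule Lim_null_comparison[where g = "\<lambda>h. 3 * \<bar>h\<bar>"])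
      show "\<forall>\<^sub>F h::real in at 0. norm (3 * (max 0 h)\<^sup>2 / h) \<le> 3 * \<bar>h\<bar>"
        by (rule always_eventually) (auto simp: max_def power2_eq_square)
      show "((\<lambda>h::real. 3 * \<bar>h\<bar>) \<longlongrightarrow> 0) (at 0)" by (auto intro!: tendsto_eq_intros)
    qed
    then show ?thesis using 2 by (simp add: DERIV_def)
  next
    case 3
    show ?thesis
      by (rule has_field_derivative_transform_within_open[of "\<lambda>x. 3 * x\<^sup>2" _ _ "{0<..}"])
         (use 3 in \<open>auto intro!: derivative_eq_intros\<close>)
  qed
qed

section \<open>The boundary layer\<close>

text \<open>Here \<open>u\<close>, \<open>x\<close>, \<open>v\<close>, \<open>y\<close> stand for
  \<open>sin s\<close>, \<open>cos s\<close>, \<open>sin t\<close>, \<open>cos t\<close>. For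
  \<open>p = - \<mu> * S - \<nu> * T\<close>, with \<open>S\<close> the side coordinate, the
  right-hand side is the image of \<open>exp p\<close> divided by \<open>exp p\<close>: the image of
  \<open>p\<close> plus its squared gradient. The drift of \<open>S\<close> gains
  \<open>\<mu> * a * (P + R)\<close>, the diffusion of \<open>T\<close> loses
  \<open>2 * \<nu> * a * (P + R)\<close>, and the squared gradient of \<open>\<nu> * T\<close>
  returns \<open>4 * \<nu>\<^sup>2 * T * a * (P + R)\<close>. Apart from the term with
  \<open>R\<^sup>2\<close>, which is negative only for \<open>x < 0\<close>, the rest is a
  polynomial in \<open>T\<close> with coefficients free of \<open>a\<close>.\<close>

lemma layer_exponent_bound:
  fixes u v x y a \<mu> \<nu> :: real
  assumes ux: "u\<^sup>2 + x\<^sup>2 = 1" and vy: "v\<^sup>2 + y\<^sup>2 = 1" and nn: "0 \<le> a" "0 \<le> \<mu>" "0 \<le> \<nu>"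
  defines "P \<equiv> u\<^sup>2" and "R \<equiv> v\<^sup>2"
  defines "T \<equiv> a * (P * R)"
  defines "S1 \<equiv> u * y * (1 + R)" and "S2 \<equiv> v * (-2 + x + (1 - x) * (2 - 3 * R))"
    and "q1 \<equiv> 2 * u * x * R" and "q2 \<equiv> 2 * v * y * P"
  shows "a * (P + R) * (\<mu> - 2 * \<nu> + 4 * \<nu>\<^sup>2 * T) + 3 * a * \<mu> * x * (1 - x) * R\<^sup>2
           - (21 * \<mu> + (2 * \<mu> + 36 * \<mu> * \<nu>) * T + 8 * \<nu>\<^sup>2 * T\<^sup>2)
         \<le> - \<mu> * (x * y * (1 + R) + y * (-2 + x + (1 - x) * (2 - 9 * R))
               - a * (P + R + 3 * x * (1 - x) * R\<^sup>2 - P * R * (1 + R)))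
           - \<nu> * a * (2 * (P + R) - 8 * (P * R))
           + ((- \<mu> * S1 - \<nu> * a * q1)\<^sup>2 + (- \<mu> * S2 - \<nu> * a * q2)\<^sup>2)"
proof -
  have P: "0 \<le> P" "P \<le> 1" "x\<^sup>2 = 1 - P" and R: "0 \<le> R" "R \<le> 1" "y\<^sup>2 = 1 - R"
    using ux vy zero_le_power2[of x] zero_le_power2[of y] unfolding P_def R_def
    by (simp_all add: algebra_simps, linarith+)
  have x: "\<bar>x\<bar> \<le> 1" and y: "\<bar>y\<bar> \<le> 1"
    using P R by (auto simp: abs_square_le_1[symmetric])
  have T: "0 \<le> T" using nn P R by (simp add: T_def)
  have xx: "\<bar>x * (1 + R)\<bar> \<le> 2"
    using mult_mono[OF x, of "1 + R" 2] R by (simp add: abs_mult)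
  have rx: "0 \<le> R * (1 - x)" "R * (1 - x) \<le> 2"
    using R x mult_mono[of R 1 "1 - x" 2] by (auto simp: abs_le_iff)
  have D: "x * y * (1 + R) + y * (-2 + x + (1 - x) * (2 - 9 * R)) \<le> 21"
  proof -
    have "x * y * (1 + R) + y * (-2 + x + (1 - x) * (2 - 9 * R)) = y * (x * (1 + R) - x - 9 * (R * (1 - x)))"
      by (simp add: algebra_simps)
    also have "\<dots> \<le> \<bar>y\<bar> * \<bar>x * (1 + R) - x - 9 * (R * (1 - x))\<bar>"
      by (simp add: abs_mult[symmetric])
    also have "\<dots> \<le> 1 * 21" by (rule mult_mono) (use xx rx x y in auto)
    finally show ?thesis by simp
  qed
  define M where "M = x * y * (1 + R) + y * (-2 + x + (1 - x) * (2 - 3 * R))"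
  have M: "- 9 \<le> M"
  proof -
    have "- M = (-y) * (x * (1 + R) - x - 3 * (R * (1 - x)))"
      by (simp add: M_def algebra_simps)
    also have "\<dots> \<le> \<bar>-y\<bar> * \<bar>x * (1 + R) - x - 3 * (R * (1 - x))\<bar>"
      by (simp add: abs_mult[symmetric])
    also have "\<dots> \<le> 1 * 9" by (rule mult_mono) (use xx rx x y in auto)
    finally show ?thesis by simp
  qed
  \<comment> \<open>The mixed product of gradients contains the factor \<open>P * R\<close>, so
    multiplied by \<open>a\<close> it is a bounded multiple of \<open>T\<close>.\<close>
  have c: "S1 * q1 + S2 * q2 = 2 * (P * R) * M"
    by (simp add: S1_def S2_def q1_def q2_def M_def P_def R_def power2_eq_square algebra_simps)
  have qq: "q1\<^sup>2 + q2\<^sup>2 = 4 * (P * R) * (P + R - 2 * (P * R))"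
  proof -
    have "q1\<^sup>2 + q2\<^sup>2 = 4 * (P * R) * (x\<^sup>2 * R + y\<^sup>2 * P)"
      by (simp add: q1_def q2_def P_def R_def power2_eq_square algebra_simps)
    then show ?thesis unfolding P(3) R(3) by (simp add: algebra_simps)
  qed
  have "(- \<mu> * S1 - \<nu> * a * q1)\<^sup>2 + (- \<mu> * S2 - \<nu> * a * q2)\<^sup>2
      = \<mu>\<^sup>2 * (S1\<^sup>2 + S2\<^sup>2) + 2 * \<mu> * \<nu> * a * (S1 * q1 + S2 * q2) + \<nu>\<^sup>2 * a\<^sup>2 * (q1\<^sup>2 + q2\<^sup>2)"
    by (simp add: power2_eq_square algebra_simps)
  also have "\<dots> \<ge> 0 + 2 * \<mu> * \<nu> * a * (S1 * q1 + S2 * q2) + \<nu>\<^sup>2 * a\<^sup>2 * (q1\<^sup>2 + q2\<^sup>2)"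
    by (intro add_mono mult_nonneg_nonneg) auto
  also have "0 + 2 * \<mu> * \<nu> * a * (S1 * q1 + S2 * q2) + \<nu>\<^sup>2 * a\<^sup>2 * (q1\<^sup>2 + q2\<^sup>2)
     = 4 * \<mu> * \<nu> * T * M + (a * (P + R) * (4 * \<nu>\<^sup>2 * T) - 8 * \<nu>\<^sup>2 * T\<^sup>2)"
    unfolding c qq T_def by (simp add: power2_eq_square algebra_simps)
  finally have 1: "4 * \<mu> * \<nu> * T * M + (a * (P + R) * (4 * \<nu>\<^sup>2 * T) - 8 * \<nu>\<^sup>2 * T\<^sup>2)
    \<le> (- \<mu> * S1 - \<nu> * a * q1)\<^sup>2 + (- \<mu> * S2 - \<nu> * a * q2)\<^sup>2" .
  have 2: "- 36 * \<mu> * \<nu> * T \<le> 4 * \<mu> * \<nu> * T * M"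
    using mult_left_mono[OF M, of "4 * \<mu> * \<nu> * T"] nn T by simp
  have 3: "\<mu> * (x * y * (1 + R) + y * (-2 + x + (1 - x) * (2 - 9 * R))) \<le> 21 * \<mu>"
    using mult_left_mono[OF D nn(2)] by simp
  have 4: "\<mu> * (T * (1 + R)) \<le> \<mu> * (T * 2)"
    using nn T R by (intro mult_left_mono) auto
  have 5: "0 \<le> 8 * \<nu> * T" using nn T by simp
  have eq: "- \<mu> * (x * y * (1 + R) + y * (-2 + x + (1 - x) * (2 - 9 * R))
               - a * (P + R + 3 * x * (1 - x) * R\<^sup>2 - P * R * (1 + R)))
           - \<nu> * a * (2 * (P + R) - 8 * (P * R))
     = - (\<mu> * (x * y * (1 + R) + y * (-2 + x + (1 - x) * (2 - 9 * R))))
       + a * (P + R) * (\<mu> - 2 * \<nu>) + 3 * a * \<mu> * x * (1 - x) * R\<^sup>2 - \<mu> * (T * (1 + R)) + 8 * \<nu> * T"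
    by (simp add: T_def algebra_simps)
  have eq2: "a * (P + R) * (\<mu> - 2 * \<nu> + 4 * \<nu>\<^sup>2 * T) = a * (P + R) * (\<mu> - 2 * \<nu>) + a * (P + R) * (4 * \<nu>\<^sup>2 * T)"
    by (simp add: algebra_simps)
  have eq3: "(2 * \<mu> + 36 * \<mu> * \<nu>) * T = \<mu> * (T * 2) + 36 * \<mu> * \<nu> * T" by (simp add: algebra_simps)
  show ?thesis unfolding eq eq2 eq3 using 1 2 3 4 5 by linarith
qed

text \<open>This term repairs the layer function near \<open>\<bar>s\<bar> = pi\<close>. Its even extension across that line has a kink,
  which is harmless because the barrier is only used for \<open>\<bar>s\<bar> \<le> pi\<close>.\<close>

lemma cube_term_bound:
  fixes a s t :: real
  assumes a: "4 \<le> a" and s: "\<bar>s\<bar> \<le> pi"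
  defines "k \<equiv> sqrt a"
  defines "w \<equiv> (sin t)\<^sup>2 / 4 - k * cos (s / 2)"
  shows "3 / 4 * a * max 0 w \<le>
    3 * (max 0 w)\<^sup>2 * ((2 - 4 * (sin t)\<^sup>2 + 2 * a * cos s * cos t * (sin t)\<^sup>2) / 4
      + k * cos (s / 2) * (1/4 - a * cos t * (sin (s / 2))\<^sup>2))
    + 6 * max 0 w * ((k * sin (s / 2) / 2)\<^sup>2 + (sin t * cos t / 2)\<^sup>2)"
proof (cases "w > 0")
  case False then show ?thesis by simp
next
  case True
  define z where "z = k * cos (s / 2)"
  have R: "0 \<le> (sin t)\<^sup>2" "(sin t)\<^sup>2 \<le> 1" by (auto simp: abs_square_le_1)
  have k2: "k\<^sup>2 = a" using a by (simp add: k_def)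
  have "0 \<le> cos (s / 2)" using s by (intro cos_ge_zero) (auto simp: abs_le_iff)
  then have z0: "0 \<le> z" using a by (simp add: z_def k_def)
  have z1: "z \<le> 1/4" using True R by (simp add: w_def z_def)
  have w1: "w \<le> 1/4" using R z0 by (simp add: w_def z_def[symmetric])
  have "\<bar>cos s * cos t * (sin t)\<^sup>2\<bar> \<le> 1"
    using R mult_le_one[of "\<bar>cos s\<bar>" "\<bar>cos t\<bar>"] mult_le_one[of "\<bar>cos s\<bar> * \<bar>cos t\<bar>" "(sin t)\<^sup>2"]
    by (simp add: abs_mult)
  then have b1: "- a \<le> a * (cos s * cos t * (sin t)\<^sup>2)"
    using mult_left_mono[of "-1" "cos s * cos t * (sin t)\<^sup>2" a] a by (simp add: abs_le_iff)
  have "cos t * (sin (s/2))\<^sup>2 \<le> 1"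
    using mult_mono[of "cos t" 1 "(sin (s/2))\<^sup>2" 1] by (simp add: abs_square_le_1)
  then have "z * (a * (cos t * (sin (s/2))\<^sup>2)) \<le> z * (a * 1)"
    using z0 a by (intro mult_left_mono) auto
  moreover have "z * (a * 1) \<le> 1/4 * (a * 1)" using z1 a by (intro mult_right_mono) auto
  ultimately have "z * (a * (cos t * (sin (s/2))\<^sup>2)) \<le> 1/4 * a" by simp
  then have b2: "- a / 4 \<le> z * (1/4 - a * cos t * (sin (s / 2))\<^sup>2)"
    using z0 by (simp add: algebra_simps)
  define g where "g = (2 - 4 * (sin t)\<^sup>2 + 2 * a * cos s * cos t * (sin t)\<^sup>2) / 4
      + z * (1/4 - a * cos t * (sin (s / 2))\<^sup>2)"
  have "- (1/2 + a / 2) \<le> (2 - 4 * (sin t)\<^sup>2 + 2 * a * cos s * cos t * (sin t)\<^sup>2) / 4"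
    using b1 R by (simp add: field_simps)
  then have g: "- (1/2 + 3 * a / 4) \<le> g" unfolding g_def using b2 by linarith
  have wg: "- (1/4 * (1/2 + 3 * a / 4)) \<le> w * g"
  proof -
    have "w * (- (1/2 + 3 * a / 4)) \<le> w * g" using g True by (intro mult_left_mono) auto
    moreover have "w * (1/2 + 3 * a / 4) \<le> 1/4 * (1/2 + 3 * a / 4)"
      using w1 a by (intro mult_right_mono) auto
    ultimately show ?thesis by (simp add: algebra_simps)
  qed
  have "(k * sin (s / 2) / 2)\<^sup>2 = (a - z\<^sup>2) / 4"
    unfolding z_def by (simp add: power_mult_distrib power_divide k2 cos_squared_eq algebra_simps)
  moreover have "z\<^sup>2 \<le> 1/16" using power_mono[OF z1 z0, of 2] by (simp add: power2_eq_square)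
  ultimately have h: "(a - 1/16) / 4 \<le> (k * sin (s / 2) / 2)\<^sup>2 + (sin t * cos t / 2)\<^sup>2"
    using zero_le_power2[of "sin t * cos t / 2"]
    by (smt (verit) divide_right_mono)
  \<comment> \<open>The image of \<open>w ^ 3\<close> is \<open>3 * w\<close> times the right-hand
    side. The factor 1/4 in \<open>w\<close> keeps \<open>w * g\<close> above about
    \<open>- 3 * a / 16\<close>, whereas twice the squared gradient is at least about
    \<open>a / 2\<close>.\<close>
  have "a / 4 \<le> w * g + 2 * ((k * sin (s / 2) / 2)\<^sup>2 + (sin t * cos t / 2)\<^sup>2)"
  proof -
    have "A / 4 \<le> x + 2 * y" if "- (1/4 * (1/2 + 3 * A / 4)) \<le> x" "(A - 1/16) / 4 \<le> y" "4 \<le> A" for A x y :: real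
      using that by (simp add: field_simps)
    then show ?thesis using wg h a by blast
  qed
  from mult_left_mono[OF this, of "3 * w"] True
  show ?thesis by (simp add: g_def z_def power2_eq_square algebra_simps)
qed


text \<open>The choice \<open>\<mu> = 4 * \<nu>\<close> turns \<open>\<mu> - 2 * \<nu>\<close> into
  \<open>2 * \<nu>\<close>. Only the term with \<open>R\<^sup>2\<close> can be negative, and it is
  at least \<open>- 24 * \<nu> * a * p * R\<^sup>2\<close>. Depending on the region it is absorbed
  by the surplus \<open>\<nu> * (P + R)\<close>, by the term with \<open>T\<close>, or, close to
  \<open>\<bar>s\<bar> = pi\<close> and away from the corners, by the cube term.\<close>

lemma layer_main_bound:
  fixes s t a \<nu> \<mu> M B :: real
  assumes a: "4 \<le> a" and s: "\<bar>s\<bar> \<le> pi"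
  defines "\<nu> \<equiv> 3000000" and "\<mu> \<equiv> 4 * \<nu>" and "M \<equiv> exp (5 * \<mu>)" and "B \<equiv> 6144 * \<nu> * M"
  defines "P \<equiv> (sin s)\<^sup>2" and "R \<equiv> (sin t)\<^sup>2"
  defines "T \<equiv> a * (P * R)" and "w \<equiv> R / 4 - sqrt a * cos (s / 2)"
  assumes p: "0 \<le> p" "p \<le> M"
  shows "\<nu> * a * p * (P + R) \<le> p * (a * (P + R) * (2 * \<nu> + 4 * \<nu>\<^sup>2 * T) + 3 * a * \<mu> * cos s * (1 - cos s) * R\<^sup>2)
            + B * (3 / 4 * a * max 0 w)"
proof -
  have nu: "0 < \<nu>" by (simp add: \<nu>_def)
  have M: "0 < M" by (simp add: M_def)
  have P: "0 \<le> P" "P \<le> 1" and R: "0 \<le> R" "R \<le> 1" by (auto simp: P_def R_def abs_square_le_1)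
  have T: "0 \<le> T" using a P R by (simp add: T_def)
  have B: "0 \<le> B * (3 / 4 * a * max 0 w)" using nu M a by (simp add: B_def)
  have aR: "0 \<le> a * p" using a p by simp
  have eq: "p * (a * (P + R) * (2 * \<nu> + 4 * \<nu>\<^sup>2 * T) + 3 * a * \<mu> * cos s * (1 - cos s) * R\<^sup>2)
     = a * p * ((P + R) * (2 * \<nu> + 4 * \<nu> * (\<nu> * T)) + 12 * \<nu> * (cos s * (1 - cos s)) * R\<^sup>2)"
    by (simp add: \<mu>_def power2_eq_square algebra_simps)
  have R2: "R\<^sup>2 \<le> R" using R by (simp add: power2_eq_square mult_left_le)
  have X: "-2 \<le> cos s * (1 - cos s)"
  proof -
    have "(cos s)\<^sup>2 \<le> 1" by (simp add: abs_square_le_1)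
    moreover have "cos s * (1 - cos s) = cos s - (cos s)\<^sup>2" by (simp add: power2_eq_square algebra_simps)
    ultimately show ?thesis using cos_ge_minus_one[of s] by linarith
  qed
  have nT: "0 \<le> \<nu> * T" using nu T by simp
  have main: ?thesis if "\<nu> * (P + R) \<le> (P + R) * (2 * \<nu> + 4 * \<nu> * (\<nu> * T)) + 12 * \<nu> * (cos s * (1 - cos s)) * R\<^sup>2"
    using mult_left_mono[OF that aR] B unfolding eq by (simp add: algebra_simps)
  have lower: "- 24 * (\<nu> * R\<^sup>2) \<le> 12 * \<nu> * (cos s * (1 - cos s)) * R\<^sup>2"
    using mult_right_mono[OF X, of "12 * \<nu> * R\<^sup>2"] nu by (simp add: algebra_simps)
  have pos: "0 \<le> (P + R) * (4 * \<nu> * (\<nu> * T))" using P R nu nT by simp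
  have pos2: "0 \<le> \<nu> * P" "0 \<le> \<nu> * R" using P R nu by simp_all
  \<comment> \<open>The thresholds balance \<open>24 * \<nu> * R\<^sup>2\<close>: it is at most
    \<open>\<nu> * R\<close> if \<open>R \<le> 1/24\<close>, and
    \<open>4 * \<nu> * (\<nu> * T)\<close> is at least \<open>24 * \<nu>\<close> if
    \<open>6 \<le> \<nu> * T\<close>. In the last case \<open>a * P < 144 / \<nu>\<close>, which
    together with \<open>cos s < 0\<close> places the point in the strip where the cube term is
    active.\<close>
  consider "0 \<le> cos s" | "R \<le> 1/24" | "6 \<le> \<nu> * T" | "cos s < 0" "1/24 < R" "\<nu> * T < 6" by linarith
  then show ?thesis
  proof cases
    case 1
    then have "0 \<le> 12 * \<nu> * (cos s * (1 - cos s)) * R\<^sup>2" using nu by simp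
    then show ?thesis using pos pos2 by (intro main) (simp add: algebra_simps)
  next
    case 2
    have "24 * R\<^sup>2 \<le> R" using 2 R mult_left_mono[of "R" "1/24" R] by (simp add: power2_eq_square)
    then have "24 * (\<nu> * R\<^sup>2) \<le> \<nu> * R" using nu by simp
    then show ?thesis using pos pos2 lower by (intro main) (simp add: algebra_simps)
  next
    case 3
    have "(P + R) * (4 * \<nu> * 6) \<le> (P + R) * (4 * \<nu> * (\<nu> * T))"
      using 3 P R nu by (intro mult_left_mono) auto
    moreover have "\<nu> * R\<^sup>2 \<le> \<nu> * R" using R2 nu by simp
    ultimately show ?thesis using pos2 lower by (intro main) (simp add: algebra_simps)
  next
    case 4
    have "P = (1 - cos s) * (1 + cos s)" by (simp add: P_def sin_squared_eq power2_eq_square algebra_simps)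
    moreover have "1 * (1 + cos s) \<le> (1 - cos s) * (1 + cos s)"
    proof (rule mult_right_mono)
      show "0 \<le> 1 + cos s" using cos_ge_minus_one[of s] by linarith
    qed (use 4 in simp)
    ultimately have XP: "1 + cos s \<le> P" by simp
    have "(sqrt a * cos (s / 2))\<^sup>2 = a * ((1 + cos s) / 2)"
      using a cos_double_cos[of "s/2"] by (simp add: power_mult_distrib)
    also have "\<dots> \<le> a * (P / 2)" using XP a by (intro mult_left_mono) auto
    also have "\<dots> \<le> 12 * T"
    proof -
      have "a * P * (1/24) \<le> a * P * R" using 4 a P by (intro mult_left_mono) auto
      then show ?thesis by (simp add: T_def)
    qed
    also have "\<dots> \<le> 72 / \<nu>" using 4 nu by (simp add: field_simps)
    \<comment> \<open>This fixes the size of \<open>\<nu>\<close>, which has to be at least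
      \<open>72 * 192\<^sup>2 = 2654208\<close>. Then \<open>w\<close> exceeds
      \<open>1/96 - 1/192 = 1/192\<close>.\<close>
    also have "\<dots> \<le> (1/192)\<^sup>2" by (simp add: \<nu>_def power2_eq_square)
    finally have "sqrt a * cos (s / 2) \<le> 1/192" by (rule power2_le_imp_le) simp
    then have w: "1/192 \<le> w" using 4 by (simp add: w_def)
    have "R\<^sup>2 \<le> 1" using R2 R by linarith
    then have "24 * \<nu> * (p * R\<^sup>2) \<le> 24 * \<nu> * (M * 1)"
      using nu p M by (intro mult_left_mono mult_mono) auto
    \<comment> \<open>The factor 6144 in \<open>B\<close> is chosen for this line:
      \<open>6144 * 3/4 / 192 = 24\<close>.\<close>
    also have "\<dots> = B * (3/4 * (1/192))" by (simp add: B_def)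
    also have "\<dots> \<le> B * (3/4 * max 0 w)" using w nu M by (intro mult_left_mono) (auto simp: B_def)
    finally have "a * (24 * \<nu> * (p * R\<^sup>2)) \<le> a * (B * (3/4 * max 0 w))" using a by (intro mult_left_mono) auto
    moreover have "\<nu> * (P + R) + - 24 * (\<nu> * R\<^sup>2) \<le> (P + R) * (2 * \<nu> + 4 * \<nu> * (\<nu> * T)) + 12 * \<nu> * (cos s * (1 - cos s)) * R\<^sup>2"
      using lower pos pos2 by (simp add: algebra_simps)
    from mult_left_mono[OF this aR] have "a * p * (\<nu> * (P + R) + - 24 * (\<nu> * R\<^sup>2)) \<le>
       p * (a * (P + R) * (2 * \<nu> + 4 * \<nu>\<^sup>2 * T) + 3 * a * \<mu> * cos s * (1 - cos s) * R\<^sup>2)"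
      unfolding eq .
    ultimately show ?thesis by (simp add: algebra_simps)
  qed
qed

text \<open>The function is \<open>exp (- \<mu> * S - \<nu> * T) + B * (max 0 w) ^ 3\<close>. The
  decay in \<open>T\<close> bounds the polynomial errors uniformly in \<open>a\<close>, so the loss
  is at most \<open>C\<close> on the whole column, while in the layer, where
  \<open>T \<le> 3\<close>, the exponential is bounded below and a fixed multiple of
  \<open>a * (P + R)\<close> is gained.\<close>

lemma layer_function:
  obtains F C M :: real where "0 < F" "0 \<le> C"
    "\<And>a. 4 \<le> a \<Longrightarrow> \<exists>e e1 e2 g. jet a e e1 e2 g \<and>
       (\<forall>s t. \<bar>s\<bar> \<le> pi \<longrightarrow> 0 \<le> e s t \<and> e s t \<le> M \<and> - C \<le> g s t \<and>
          (a * ((sin s)\<^sup>2 * (sin t)\<^sup>2) \<le> 3 \<longrightarrow> F * (a * ((sin s)\<^sup>2 + (sin t)\<^sup>2)) - C \<le> g s t))"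
proof -
  define \<nu> :: real where "\<nu> = 3000000"
  define \<mu> where "\<mu> = 4 * \<nu>"
  define M where "M = exp (5 * \<mu>)"
  define B where "B = 6144 * \<nu> * M"
  \<comment> \<open>The numbers \<open>1\<close>, \<open>1 / \<nu>\<close> and
    \<open>2 / \<nu>\<^sup>2\<close> bound \<open>exp (- \<nu> * T)\<close> times \<open>1\<close>,
    \<open>T\<close> and \<open>T\<^sup>2\<close>; \<open>M\<close> bounds
    \<open>exp (- \<mu> * S)\<close>, because \<open>\<bar>S\<bar> \<le> 5\<close>. The next
    constant, \<open>F\<close>, is \<open>\<nu>\<close> times a lower bound of the exponential for
    \<open>T \<le> 3\<close>.\<close>
  define C where "C = M * (21 * \<mu> + (2 * \<mu> + 36 * \<mu> * \<nu>) * (1 / \<nu>) + 8 * \<nu>\<^sup>2 * (2 / \<nu>\<^sup>2))"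
  define F where "F = \<nu> * exp (- 5 * \<mu> - 3 * \<nu>)"
  have nu: "0 < \<nu>" "0 < \<mu>" by (simp_all add: \<nu>_def \<mu>_def)
  have M: "0 < M" by (simp add: M_def)
  have C: "0 \<le> C" using nu M by (simp add: C_def)
  have F: "0 < F" using nu by (simp add: F_def)
  show thesis
  proof (rule that[OF F C, of "M + B"])
    fix a :: real assume a: "4 \<le> a"
    define p where "p s t = - \<mu> * (2 * cos t - cos s * cos t + (1 - cos s) * cos t * (sin t)\<^sup>2)
        + - \<nu> * a * ((sin s)\<^sup>2 * (sin t)\<^sup>2)" for s t
    define w where "w s t = (sin t)\<^sup>2 / 4 - sqrt a * cos (s / 2)" for s t
    note jp = jet_add[OF jet_cmult[OF jet_side_coordinate[of a], of "-\<mu>"] jet_cmult[OF jet_sin_sq_prod[of a], of "- \<nu> * a"], folded p_def]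
    note je = jet_comp[OF jp, of exp exp exp, OF DERIV_exp DERIV_exp]
    note jw = jet_cmult[OF jet_comp[OF jet_edge_distance[of a "sqrt a", folded w_def] DERIV_pos_cube], of B]
    note j = jet_add[OF je jw]
    show "\<exists>e e1 e2 g. jet a e e1 e2 g \<and>
       (\<forall>s t. \<bar>s\<bar> \<le> pi \<longrightarrow> 0 \<le> e s t \<and> e s t \<le> M + B \<and> - C \<le> g s t \<and>
          (a * ((sin s)\<^sup>2 * (sin t)\<^sup>2) \<le> 3 \<longrightarrow> F * (a * ((sin s)\<^sup>2 + (sin t)\<^sup>2)) - C \<le> g s t))"
    proof (rule exI, rule exI, rule exI, rule exI, rule conjI, rule j, rule allI, rule allI, rule impI, goal_cases)
      case (1 s t)
      define P where "P = (sin s)\<^sup>2"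
      define R where "R = (sin t)\<^sup>2"
      define T where "T = a * (P * R)"
      have P: "0 \<le> P" "P \<le> 1" and R: "0 \<le> R" "R \<le> 1" by (auto simp: P_def R_def abs_square_le_1)
      have T: "0 \<le> T" using a P R by (simp add: T_def)
      define S where "S = 2 * cos t - cos s * cos t + (1 - cos s) * cos t * R"
      have pS: "p s t = - \<mu> * S - \<nu> * T" by (simp add: p_def S_def T_def P_def R_def)
      have S: "\<bar>S\<bar> \<le> 5"
      proof -
        have "S = cos t * (2 - cos s + (1 - cos s) * R)" by (simp add: S_def algebra_simps)
        moreover have "0 \<le> (1 - cos s) * R" "(1 - cos s) * R \<le> 2 * 1"
        proof -
          have c: "0 \<le> 1 - cos s" "1 - cos s \<le> 2" using cos_ge_minus_one[of s] cos_le_one[of s] by linarith+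
          show "0 \<le> (1 - cos s) * R" using c R by simp
          show "(1 - cos s) * R \<le> 2 * 1" using c R by (intro mult_mono) auto
        qed
        moreover from this have "\<bar>2 - cos s + (1 - cos s) * R\<bar> \<le> 5"
          using cos_ge_minus_one[of s] cos_le_one[of s] by linarith
        ultimately have "\<bar>S\<bar> \<le> 1 * 5"
          by (simp only: abs_mult, intro mult_mono) auto
        then show ?thesis by simp
      qed
      define E where "E = exp (p s t)"
      have E: "0 < E" by (simp add: E_def)
      have "- \<mu> * S \<le> 5 * \<mu>" "- 5 * \<mu> \<le> - \<mu> * S" using mult_left_mono[of "-S" 5 \<mu>] mult_left_mono[of S 5 \<mu>] S nu
        by (auto simp: abs_le_iff)
      then have EM: "E \<le> M * exp (- (\<nu> * T))" and EL: "exp (- 5 * \<mu> - \<nu> * T) \<le> E"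
        by (auto simp: E_def M_def pS exp_add[symmetric])
      have nT: "0 \<le> \<nu> * T" using nu T by simp
      have "M * exp (- (\<nu> * T)) \<le> M * 1" using M nT by (intro mult_left_mono) auto
      then have EM1: "E \<le> M" using EM by linarith
      have t1: "exp (- (\<nu> * T)) * T \<le> 1 / \<nu>"
      proof -
        have "\<nu> * T \<le> exp (\<nu> * T)" using exp_ge_add_one_self[of "\<nu> * T"] by linarith
        then show ?thesis using nu by (simp add: exp_minus field_simps)
      qed
      have t2: "exp (- (\<nu> * T)) * T\<^sup>2 \<le> 2 / \<nu>\<^sup>2"
      proof -
        have "(\<nu> * T)\<^sup>2 / 2 \<le> exp (\<nu> * T)" using exp_lower_Taylor_quadratic[OF nT] nT by linarith
        then show ?thesis using nu by (simp add: exp_minus field_simps power_mult_distrib)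
      qed
      have t0: "exp (- (\<nu> * T)) \<le> 1" using nT by simp
      define D where "D = 21 * \<mu> + (2 * \<mu> + 36 * \<mu> * \<nu>) * T + 8 * \<nu>\<^sup>2 * T\<^sup>2"
      have D0: "0 \<le> D" using nu T by (simp add: D_def)
      have "E * D \<le> M * exp (- (\<nu> * T)) * D" using EM D0 by (intro mult_right_mono)
      also have "\<dots> = M * (21 * \<mu> * exp (- (\<nu> * T)) + (2 * \<mu> + 36 * \<mu> * \<nu>) * (exp (- (\<nu> * T)) * T)
          + 8 * \<nu>\<^sup>2 * (exp (- (\<nu> * T)) * T\<^sup>2))" by (simp add: D_def algebra_simps)
      also have "\<dots> \<le> M * (21 * \<mu> * 1 + (2 * \<mu> + 36 * \<mu> * \<nu>) * (1 / \<nu>) + 8 * \<nu>\<^sup>2 * (2 / \<nu>\<^sup>2))"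
        using M nu t0 t1 t2 by (intro mult_left_mono add_mono) auto
      finally have ED: "E * D \<le> C" by (simp add: C_def)
      define G where "G = - \<mu> * (cos s * cos t * (1 + R) + cos t * (-2 + cos s + (1 - cos s) * (2 - 9 * R))
               - a * (P + R + 3 * cos s * (1 - cos s) * R\<^sup>2 - P * R * (1 + R)))
           - \<nu> * a * (2 * (P + R) - 8 * (P * R))
           + ((- \<mu> * (sin s * cos t * (1 + R)) - \<nu> * a * (2 * sin s * cos s * R))\<^sup>2
             + (- \<mu> * (sin t * (-2 + cos s + (1 - cos s) * (2 - 3 * R))) - \<nu> * a * (2 * sin t * cos t * P))\<^sup>2)"
      have G: "a * (P + R) * (2 * \<nu> + 4 * \<nu>\<^sup>2 * T) + 3 * a * \<mu> * cos s * (1 - cos s) * R\<^sup>2 - D \<le> G"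
        using layer_exponent_bound[of "sin s" "cos s" "sin t" "cos t" a \<mu> \<nu>, OF sin_cos_squared_add sin_cos_squared_add, folded P_def R_def, folded T_def] a nu
        by (simp add: G_def D_def \<mu>_def)
      define W where "W = 3 * (max 0 (w s t))\<^sup>2 * ((2 - 4 * (sin t)\<^sup>2 + 2 * a * cos s * cos t * (sin t)\<^sup>2) / 4
          + sqrt a * cos (s / 2) * (1/4 - a * cos t * (sin (s / 2))\<^sup>2))
        + 6 * max 0 (w s t) * ((sqrt a * sin (s / 2) / 2)\<^sup>2 + (sin t * cos t / 2)\<^sup>2)"
      have W: "3 / 4 * a * max 0 (w s t) \<le> W"
        using cube_term_bound[OF a 1, of t] unfolding W_def w_def .
      have B0: "0 \<le> B" using nu M by (simp add: B_def)
      have "\<nu> * a * E * (P + R) \<le> E * (a * (P + R) * (2 * \<nu> + 4 * \<nu>\<^sup>2 * T) + 3 * a * \<mu> * cos s * (1 - cos s) * R\<^sup>2)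
            + B * (3 / 4 * a * max 0 (w s t))"
        using layer_main_bound[OF a 1, of E t] E EM1
        unfolding T_def P_def R_def w_def B_def M_def \<mu>_def \<nu>_def by simp
      also have "\<dots> \<le> E * (G + D) + B * W"
      proof (rule add_mono)
        show "E * (a * (P + R) * (2 * \<nu> + 4 * \<nu>\<^sup>2 * T) + 3 * a * \<mu> * cos s * (1 - cos s) * R\<^sup>2) \<le> E * (G + D)"
          using G E by (intro mult_left_mono) linarith+
        show "B * (3 / 4 * a * max 0 (w s t)) \<le> B * W" using W B0 by (rule mult_left_mono)
      qed
      finally have key: "\<nu> * a * E * (P + R) - C \<le> E * G + B * W" using ED by (simp add: algebra_simps)
      have geq: "exp (p s t) * (- \<mu> * (cos s * cos t * (1 + (sin t)\<^sup>2) + cos t * (-2 + cos s + (1 - cos s) * (2 - 9 * (sin t)\<^sup>2))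
           - a * ((sin s)\<^sup>2 + (sin t)\<^sup>2 + 3 * cos s * (1 - cos s) * ((sin t)\<^sup>2)\<^sup>2
           - (sin s)\<^sup>2 * (sin t)\<^sup>2 * (1 + (sin t)\<^sup>2)))
          + - \<nu> * a * (2 * ((sin s)\<^sup>2 + (sin t)\<^sup>2) - 8 * ((sin s)\<^sup>2 * (sin t)\<^sup>2)))
         + exp (p s t) * ((- \<mu> * (sin s * cos t * (1 + (sin t)\<^sup>2)) + - \<nu> * a * (2 * sin s * cos s * (sin t)\<^sup>2))\<^sup>2
           + (- \<mu> * (sin t * (-2 + cos s + (1 - cos s) * (2 - 3 * (sin t)\<^sup>2))) + - \<nu> * a * (2 * sin t * cos t * (sin s)\<^sup>2))\<^sup>2)
        = E * G"
        unfolding E_def G_def P_def[symmetric] R_def[symmetric] distrib_left[symmetric] by simp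
      have wb: "max 0 (w s t) \<le> 1"
      proof -
        have "0 \<le> cos (s / 2)" using 1 by (intro cos_ge_zero) (auto simp: abs_le_iff)
        then have "0 \<le> sqrt a * cos (s / 2)" using a by simp
        then show ?thesis using R unfolding w_def R_def[symmetric] by linarith
      qed
      have "\<nu> * a * exp (- 5 * \<mu> - 3 * \<nu>) * (P + R) \<le> \<nu> * a * E * (P + R)" if "T \<le> 3"
        using that nu a P R EL by (intro mult_right_mono mult_left_mono order_trans[OF _ EL]) auto
      then have "F * (a * (P + R)) \<le> \<nu> * a * E * (P + R)" if "T \<le> 3"
        using that by (simp add: F_def algebra_simps)
      moreover have "0 \<le> \<nu> * a * E * (P + R)" using nu a E P R by simp
      ultimately show ?case
        using key EM1 E B0 wb power_le_one[of "max 0 (w s t)" 3]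
        unfolding geq W_def[symmetric] unfolding P_def[symmetric] R_def[symmetric] T_def[symmetric] E_def[symmetric]
        by (auto intro!: add_mono mult_left_le)
    qed
  qed
qed

section \<open>The cell interior and the stagnation points\<close>

text \<open>In the application \<open>\<sigma>\<^sup>2 = r = P * R + 1 / a\<close>,
  \<open>\<beta>\<^sup>2 = 1 / a\<close>, \<open>l = 3 - ln \<sigma>\<close>, and \<open>h1\<close>,
  \<open>h2\<close> are the first two derivatives in \<open>r\<close> of
  \<open>\<sigma> * l + \<Lambda> * \<beta> * ln r\<close>. Since \<open>P * R\<close> is conserved
  by the flow, the image \<open>g\<close> contains no drift. If \<open>q\<close> were
  \<open>\<sigma>\<^sup>2\<close>, the coefficient of \<open>2 * (P + R)\<close> would be \<open>- 1
  / (2 * \<sigma>) - \<Lambda> * \<beta> / \<sigma>\<^sup>2\<close>; the second part, due to the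
  logarithm, pays for the shift by \<open>\<beta>\<^sup>2\<close>.\<close>

lemma interior_profile_bounds:
  fixes \<beta> \<sigma> \<Lambda> l P R :: real
  assumes \<beta>: "0 < \<beta>" "\<beta> \<le> \<sigma>" and l: "2 \<le> l" "l \<le> \<Lambda>" and PR: "0 \<le> P" "0 \<le> R" "P * R = \<sigma>\<^sup>2 - \<beta>\<^sup>2"
  defines "q \<equiv> P * R"
  defines "h1 \<equiv> (l - 1) / (2 * \<sigma>) + \<Lambda> * \<beta> / \<sigma>\<^sup>2" and "h2 \<equiv> - l / (4 * \<sigma> ^ 3) - \<Lambda> * \<beta> / \<sigma> ^ 4"
  defines "g \<equiv> h1 * (2 * (P + R) - 8 * q) + h2 * (4 * q * (P + R - 2 * q))"
  shows "2 * \<beta> \<le> \<sigma> \<Longrightarrow> g \<le> - ((P + R) / \<sigma>)"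
    and "g \<le> 5 * (\<Lambda> / \<beta>) * (P + R)"
proof -
  have \<sigma>: "0 < \<sigma>" using \<beta> by simp
  have \<Lambda>: "0 < \<Lambda>" using l by simp
  have q: "q = \<sigma>\<^sup>2 - \<beta>\<^sup>2" "0 \<le> q" using PR mult_nonneg_nonneg[OF PR(1,2)] unfolding q_def by blast+
  have A: "h1 + 2 * q * h2 = - (1 / (2 * \<sigma>) + \<Lambda> * \<beta> / \<sigma>\<^sup>2 - \<beta>\<^sup>2 * l / (2 * \<sigma> ^ 3) - 2 * \<Lambda> * \<beta> ^ 3 / \<sigma> ^ 4)"
    unfolding h1_def h2_def q(1) using \<sigma> by (simp add: field_simps power2_eq_square power3_eq_cube power4_eq_xxxx)
  have "h1 + q * h2 = (l / 4 - 1 / 2) / \<sigma> + \<beta>\<^sup>2 * l / (4 * \<sigma> ^ 3) + \<Lambda> * \<beta> ^ 3 / \<sigma> ^ 4"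
    unfolding h1_def h2_def q(1) using \<sigma> by (simp add: field_simps power2_eq_square power3_eq_cube power4_eq_xxxx)
  also have "\<dots> \<ge> 0" using \<sigma> l \<Lambda> \<beta> by (intro add_nonneg_nonneg divide_nonneg_pos mult_nonneg_nonneg) auto
  finally have B: "0 \<le> 8 * q * (h1 + q * h2)" using q by simp
  have g: "g = 2 * (P + R) * (h1 + 2 * q * h2) - 8 * q * (h1 + q * h2)"
    by (simp add: g_def algebra_simps)
  have S: "0 \<le> 2 * (P + R)" using PR by simp
  {
    assume b: "2 * \<beta> \<le> \<sigma>"
    \<comment> \<open>The two errors of the shift use up a quarter and a half of
      \<open>\<Lambda> * \<beta> / \<sigma>\<^sup>2\<close>.\<close>
    have "\<beta>\<^sup>2 * l / (2 * \<sigma> ^ 3) \<le> \<Lambda> * \<beta> / (4 * \<sigma>\<^sup>2)"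
    proof -
      have "\<beta>\<^sup>2 * l / (2 * \<sigma> ^ 3) = (l * (2 * \<beta>)) * (\<beta> / (4 * \<sigma> ^ 3))" by (simp add: power2_eq_square)
      also have "\<dots> \<le> (\<Lambda> * \<sigma>) * (\<beta> / (4 * \<sigma> ^ 3))"
        using b l \<beta> \<sigma> by (intro mult_right_mono mult_mono) auto
      also have "\<dots> = \<Lambda> * \<beta> / (4 * \<sigma>\<^sup>2)" using \<sigma> by (simp add: power2_eq_square power3_eq_cube)
      finally show ?thesis .
    qed
    moreover have "2 * \<Lambda> * \<beta> ^ 3 / \<sigma> ^ 4 \<le> \<Lambda> * \<beta> / (2 * \<sigma>\<^sup>2)"
    proof -
      have "(2 * \<beta>)\<^sup>2 \<le> \<sigma>\<^sup>2" using b \<beta> by (intro power_mono) auto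
      then have "(2 * \<beta>)\<^sup>2 * (\<Lambda> * \<beta> / (2 * \<sigma> ^ 4)) \<le> \<sigma>\<^sup>2 * (\<Lambda> * \<beta> / (2 * \<sigma> ^ 4))"
        using \<Lambda> \<beta> by (intro mult_right_mono) auto
      then show ?thesis using \<sigma> by (simp add: power2_eq_square power3_eq_cube power4_eq_xxxx)
    qed
    moreover have "0 \<le> \<Lambda> * \<beta> / (4 * \<sigma>\<^sup>2)" "\<Lambda> * \<beta> / \<sigma>\<^sup>2 = 4 * (\<Lambda> * \<beta> / (4 * \<sigma>\<^sup>2))" "\<Lambda> * \<beta> / (2 * \<sigma>\<^sup>2) = 2 * (\<Lambda> * \<beta> / (4 * \<sigma>\<^sup>2))"
      using \<Lambda> \<beta> by auto
    ultimately have "h1 + 2 * q * h2 \<le> - (1 / (2 * \<sigma>))" unfolding A by linarith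
    from mult_left_mono[OF this S] have "2 * (P + R) * (h1 + 2 * q * h2) \<le> - ((P + R) / \<sigma>)"
      using \<sigma> by (simp add: add_divide_distrib algebra_simps)
    then show "g \<le> - ((P + R) / \<sigma>)" using B unfolding g by linarith
  }
  have "\<beta>\<^sup>2 * l / (2 * \<sigma> ^ 3) \<le> \<Lambda> / (2 * \<beta>)"
  proof -
    have "\<beta>\<^sup>2 * l / (2 * \<sigma> ^ 3) \<le> \<beta>\<^sup>2 * \<Lambda> / (2 * \<beta> ^ 3)"
      using \<beta> l by (intro frac_le mult_left_mono power_mono mult_pos_pos) auto
    then show ?thesis using \<beta> by (simp add: power2_eq_square power3_eq_cube)
  qed
  moreover have "2 * \<Lambda> * \<beta> ^ 3 / \<sigma> ^ 4 \<le> 2 * (\<Lambda> / \<beta>)"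
  proof -
    have "2 * \<Lambda> * \<beta> ^ 3 / \<sigma> ^ 4 \<le> 2 * \<Lambda> * \<beta> ^ 3 / \<beta> ^ 4"
      using \<beta> \<Lambda> by (intro divide_left_mono power_mono mult_pos_pos) auto
    then show ?thesis using \<beta> by (simp add: power3_eq_cube power4_eq_xxxx)
  qed
  moreover have "0 \<le> 1 / (2 * \<sigma>)" "0 \<le> \<Lambda> * \<beta> / \<sigma>\<^sup>2" using \<sigma> \<Lambda> \<beta> by auto
  moreover have "\<Lambda> / (2 * \<beta>) = 1 / 2 * (\<Lambda> / \<beta>)" by simp
  ultimately have "h1 + 2 * q * h2 \<le> 5 / 2 * (\<Lambda> / \<beta>)" unfolding A by linarith
  from mult_left_mono[OF this S] have "2 * (P + R) * (h1 + 2 * q * h2) \<le> 2 * (P + R) * (5 / 2 * (\<Lambda> / \<beta>))" .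
  also have "\<dots> = 5 * (\<Lambda> / \<beta>) * (P + R)" by (simp add: add_divide_distrib algebra_simps)
  finally show "g \<le> 5 * (\<Lambda> / \<beta>) * (P + R)" using B unfolding g by linarith
qed

text \<open>The summand \<open>1 / a\<close> smooths the profile across the separatrices. The
  logarithm is normalised as \<open>ln (a * r)\<close> to vanish at \<open>r = 1 / a\<close>, so the
  value on \<open>sin s = 0\<close> is exactly \<open>\<epsilon>\<close>, which is also the
  coefficient of this logarithm.\<close>

lemma interior_function:
  fixes a :: real
  assumes a: "4 \<le> a"
  defines "\<epsilon> \<equiv> (3 + ln a / 2) / sqrt a"
  shows "\<exists>f f1 f2 g. jet a f f1 f2 g \<and>
    (\<forall>s t. 0 \<le> f s t \<and> f s t \<le> 7 + \<epsilon> * ln (1 + a) \<and> (sin s = 0 \<longrightarrow> f s t = \<epsilon>) \<and>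
       (let P = (sin s)\<^sup>2; R = (sin t)\<^sup>2 in
        (3 \<le> a * (P * R) \<longrightarrow> g s t \<le> - ((P + R) / sqrt (P * R + 1 / a))) \<and> g s t \<le> 5 * (\<epsilon> * a) * (P + R)))"
proof -
  have a0: "0 < a" using a by simp
  define h where "h r = sqrt r * (3 - ln r / 2) + \<epsilon> * ln (a * r)" for r
  define h1 where "h1 r = (2 - ln r / 2) / (2 * sqrt r) + \<epsilon> / r" for r
  define h2 where "h2 r = - (3 - ln r / 2) / (4 * sqrt r ^ 3) - \<epsilon> / r\<^sup>2" for r
  have sq: "sqrt r * sqrt r = r" if "0 < r" for r :: real using that by simp
  have h: "(h has_real_derivative h1 r) (at r)" if r: "0 < r" for r
  proof -
    have "(h has_real_derivative (inverse (sqrt r) / 2) * (3 - ln r / 2) + sqrt r * (- (1 / r) / 2) + \<epsilon> * (a / (a * r))) (at r)"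
      unfolding h_def using r a0 by (auto intro!: derivative_eq_intros simp: field_simps)
    moreover have "sqrt r * (- (1 / r) / 2) = - (1 / (2 * sqrt r))"
      using r sq[OF r] by (simp add: field_simps)
    moreover have "\<epsilon> * (a / (a * r)) = \<epsilon> / r" using a0 by simp
    moreover have "(inverse (sqrt r) / 2) * (3 - ln r / 2) + - (1 / (2 * sqrt r)) = (2 - ln r / 2) / (2 * sqrt r)"
      using r by (simp add: field_simps)
    ultimately show ?thesis unfolding h1_def by simp
  qed
  have h1: "(h1 has_real_derivative h2 r) (at r)" if r: "0 < r" for r
  proof -
    have "(h1 has_real_derivative ((- (1 / r) / 2) * (2 * sqrt r) - (2 - ln r / 2) * (2 * (inverse (sqrt r) / 2))) / (2 * sqrt r)\<^sup>2
       + - \<epsilon> / r\<^sup>2) (at r)"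
      unfolding h1_def using r by (auto intro!: derivative_eq_intros simp: field_simps power2_eq_square)
    moreover have "((- (1 / r) / 2) * (2 * sqrt r) - (2 - ln r / 2) * (2 * (inverse (sqrt r) / 2))) / (2 * sqrt r)\<^sup>2
       = - (3 - ln r / 2) / (4 * sqrt r ^ 3)"
    proof -
      define u where "u = sqrt r"
      have u: "0 < u" "r = u\<^sup>2" using r by (simp_all add: u_def)
      show ?thesis unfolding u_def[symmetric] unfolding u(2) using u(1)
        by (simp add: field_simps power2_eq_square power3_eq_cube)
    qed
    ultimately show ?thesis unfolding h2_def by simp
  qed
  have pos: "0 < (sin s)\<^sup>2 * (sin t)\<^sup>2 + 1 / a" for s t :: real
    using a0 by (intro add_nonneg_pos) auto
  note j = jet_comp[OF jet_add[OF jet_sin_sq_prod[of a] jet_const[of a "1 / a"]], of h h1 h2, OF h h1, OF pos pos]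
  show ?thesis
  proof (rule exI, rule exI, rule exI, rule exI, rule conjI, rule j, rule allI, rule allI, goal_cases)
    case (1 s t)
    define P where "P = (sin s)\<^sup>2"
    define R where "R = (sin t)\<^sup>2"
    have P: "0 \<le> P" "P \<le> 1" and R: "0 \<le> R" "R \<le> 1" by (auto simp: P_def R_def abs_square_le_1)
    define r where "r = P * R + 1 / a"
    define \<beta> where "\<beta> = 1 / sqrt a"
    define \<sigma> where "\<sigma> = sqrt r"
    define l where "l = 3 - ln r / 2"
    define \<Lambda> where "\<Lambda> = 3 + ln a / 2"
    have q: "0 \<le> P * R" "P * R \<le> 1" using P R by (auto simp: mult_le_one)
    have a14: "0 < 1 / a" "1 / a \<le> 1/4" using a by (auto simp: field_simps)
    have r: "1 / a \<le> r" "r \<le> 5/4" "0 < r" using q a14 unfolding r_def by linarith+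
    have \<beta>: "0 < \<beta>" "\<beta>\<^sup>2 = 1 / a" using a0 by (auto simp: \<beta>_def power_divide)
    have \<beta>\<sigma>: "\<beta> \<le> \<sigma>" using r(1) a0 real_sqrt_le_mono[OF r(1)] by (simp add: \<beta>_def \<sigma>_def real_sqrt_divide)
    have \<sigma>: "0 < \<sigma>" "\<sigma>\<^sup>2 = r" using r by (auto simp: \<sigma>_def)
    have \<epsilon>: "\<epsilon> = \<Lambda> * \<beta>" by (simp add: \<epsilon>_def \<Lambda>_def \<beta>_def)
    have "ln r \<le> 1" using ln_le_minus_one[OF r(3)] r by linarith
    then have l2: "2 \<le> l" by (simp add: l_def)
    have "- ln a \<le> ln r" using r a0 ln_le_cancel_iff[of "1/a" r] by (simp add: ln_div)
    then have l\<Lambda>: "l \<le> \<Lambda>" by (simp add: l_def \<Lambda>_def)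
    have \<epsilon>0: "0 \<le> \<epsilon>" using l2 l\<Lambda> \<beta> by (simp add: \<epsilon>)
    have PRe: "P * R = \<sigma>\<^sup>2 - \<beta>\<^sup>2" using \<sigma> \<beta> by (simp add: r_def)
    note B = interior_profile_bounds[OF \<beta>(1) \<beta>\<sigma> l2 l\<Lambda> P(1) R(1) PRe]
    have e1: "h1 r = (l - 1) / (2 * \<sigma>) + \<Lambda> * \<beta> / \<sigma>\<^sup>2"
      unfolding h1_def \<epsilon> \<sigma>(2) by (simp add: l_def \<sigma>_def)
    have e2: "h2 r = - l / (4 * \<sigma> ^ 3) - \<Lambda> * \<beta> / \<sigma> ^ 4"
    proof -
      have "\<sigma> ^ 4 = r\<^sup>2" unfolding \<sigma>(2)[symmetric] by simp
      then show ?thesis unfolding h2_def \<epsilon> by (simp add: l_def \<sigma>_def)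
    qed
    have \<Gamma>: "(2 * sin s * cos s * R)\<^sup>2 + (2 * sin t * cos t * P)\<^sup>2 = 4 * (P * R) * (P + R - 2 * (P * R))"
    proof -
      have "(2 * sin s * cos s * R)\<^sup>2 + (2 * sin t * cos t * P)\<^sup>2 = 4 * (P * R) * ((cos s)\<^sup>2 * R + (cos t)\<^sup>2 * P)"
        by (simp add: P_def R_def power2_eq_square algebra_simps)
      then show ?thesis unfolding cos_squared_eq P_def[symmetric] R_def[symmetric] by (simp add: algebra_simps)
    qed
    have ea: "\<Lambda> / \<beta> = \<epsilon> * a" using \<beta> a0 unfolding \<epsilon> by (simp add: field_simps power2_eq_square)
    \<comment> \<open>The condition \<open>2 * \<beta> \<le> \<sigma>\<close> reads
      \<open>4 / a \<le> P * R + 1 / a\<close>; this is the origin of the threshold 3 that separates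
      layer and interior.\<close>
    have out: "2 * \<beta> \<le> \<sigma>" if "3 \<le> a * (P * R)"
    proof (rule power2_le_imp_le)
      show "(2 * \<beta>)\<^sup>2 \<le> \<sigma>\<^sup>2" using that a0 unfolding power_mult_distrib \<beta>(2) \<sigma>(2) by (simp add: r_def field_simps)
    qed (use \<sigma> in simp)
    have "sqrt (P * R + 1 / a) = \<sigma>" by (simp add: \<sigma>_def r_def)
    then have bounds: "(3 \<le> a * (P * R) \<longrightarrow> h1 r * (2 * (P + R) - 8 * (P * R)) + h2 r * ((2 * sin s * cos s * R)\<^sup>2 + (2 * sin t * cos t * P)\<^sup>2) \<le> - ((P + R) / sqrt (P * R + 1 / a)))
       \<and> h1 r * (2 * (P + R) - 8 * (P * R)) + h2 r * ((2 * sin s * cos s * R)\<^sup>2 + (2 * sin t * cos t * P)\<^sup>2) \<le> 5 * (\<epsilon> * a) * (P + R)"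
      using B out unfolding \<Gamma> e1 e2 ea by simp
    have h0: "0 \<le> h r"
    proof -
      have "1 \<le> a * r" using r a0 by (simp add: field_simps)
      then show ?thesis using l2 \<sigma> \<epsilon>0 unfolding h_def l_def[symmetric] \<sigma>_def[symmetric] by simp
    qed
    have h7: "h r \<le> 7 + \<epsilon> * ln (1 + a)"
    proof -
      have "\<sigma> \<le> 2" by (rule power2_le_imp_le) (use \<sigma> r in auto)
      moreover have "- (\<sigma> * ln r / 2) \<le> 1"
      proof -
        have "ln r / 2 = - ln (1 / \<sigma>)" using \<sigma> unfolding \<sigma>(2)[symmetric] by (simp add: ln_div ln_realpow)
        moreover have "ln (1 / \<sigma>) \<le> 1 / \<sigma> - 1" using \<sigma> by (intro ln_le_minus_one) auto
        then have "\<sigma> * ln (1 / \<sigma>) \<le> \<sigma> * (1 / \<sigma> - 1)" using \<sigma> by (intro mult_left_mono) auto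
        ultimately show ?thesis using \<sigma> by (simp add: algebra_simps)
      qed
      moreover have "\<epsilon> * ln (a * r) \<le> \<epsilon> * ln (1 + a)"
      proof -
        have "a * r = 1 + a * (P * R)" using a0 by (simp add: r_def algebra_simps)
        moreover have "a * (P * R) \<le> a * 1" using q a0 by (intro mult_left_mono) auto
        moreover have "0 \<le> a * (P * R)" using q a0 by simp
        ultimately show ?thesis using \<epsilon>0 a0 by (intro mult_left_mono) auto
      qed
      ultimately show ?thesis unfolding h_def \<sigma>_def[symmetric] by (simp add: algebra_simps)
    qed
    have hs: "h r = \<epsilon>" if "sin s = 0"
    proof -
      have "r = 1 / a" using that by (simp add: r_def P_def)
      then show ?thesis using a0 unfolding h_def \<epsilon>_def by (simp add: ln_div real_sqrt_divide)
    qed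
    show ?case using bounds h0 h7 hs unfolding Let_def P_def[symmetric] R_def[symmetric] r_def[symmetric] by simp
  qed
qed

text \<open>The right-hand side is the image of \<open>ln (1 + a * x)\<close> for
  \<open>x = (sin t)\<^sup>2\<close> and \<open>\<eta> = cos s * cos t\<close>, or for
  \<open>x = (sin s)\<^sup>2\<close> and \<open>\<eta> = - cos s * cos t\<close>. In the expanding
  direction of a stagnation point, \<open>x\<close> grows exponentially at a rate of order
  \<open>a\<close>, so its logarithm grows linearly; where \<open>a * x\<close> is small, diffusion
  takes over this role. For \<open>\<eta> = 1\<close> both effects together give at least
  \<open>a - 1\<close> for every \<open>x\<close>.\<close>

lemma corner_log_bound:
  fixes a x \<eta> :: real
  assumes a: "0 < a" and x: "0 \<le> x" "x \<le> 1" and \<eta>: "\<eta> \<le> 1"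
  shows "a * (1 - 2 * (1 - \<eta>)) - 1
     \<le> a / (1 + a * x) * (2 - 4 * x + 2 * a * \<eta> * x) + - a\<^sup>2 / (1 + a * x)\<^sup>2 * (4 * x * (1 - x))"
proof -
  define S where "S = a * x"
  have S: "0 \<le> S" using a x by (simp add: S_def)
  have x': "x = S / a" using a by (simp add: S_def)
  have "a / (1 + S) * (2 - 4 * x + 2 * a * \<eta> * x) + - a\<^sup>2 / (1 + S)\<^sup>2 * (4 * x * (1 - x))
     = a * (1 - 2 * (1 - \<eta>) * (S / (1 + S))) + a * ((1 - S)\<^sup>2 / (1 + S)\<^sup>2) - 4 * S / (1 + S)\<^sup>2"
  proof -
    define d where "d = 1 + S"
    have d: "d \<noteq> 0" "S = d - 1" using S by (simp_all add: d_def)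
    show ?thesis unfolding d_def[symmetric] x' unfolding d(2) using d(1) a
      by (simp add: field_simps power2_eq_square)
  qed
  moreover have "4 * S / (1 + S)\<^sup>2 \<le> 1"
  proof -
    have "4 * S \<le> (1 + S)\<^sup>2" using zero_le_power2[of "1 - S"] by (simp add: power2_eq_square algebra_simps)
    then show ?thesis using S by (simp add: divide_le_eq_1)
  qed
  moreover have "0 \<le> a * ((1 - S)\<^sup>2 / (1 + S)\<^sup>2)" using a by simp
  moreover have "a * (1 - 2 * (1 - \<eta>) * 1) \<le> a * (1 - 2 * (1 - \<eta>) * (S / (1 + S)))"
    using a \<eta> S by (intro mult_left_mono diff_left_mono) auto
  ultimately show ?thesis unfolding S_def[symmetric] by simp
qed

text \<open>The function is a constant minus the mean of \<open>ln (1 + a * R)\<close> and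
  \<open>ln (1 + a * P)\<close> with weights \<open>(1 + cos s * cos t) / 2\<close> and
  \<open>(1 - cos s * cos t) / 2\<close>, which select at each corner the direction in which the
  flow leaves it. Its size \<open>ln a / a\<close> is that of the escape time from a saddle. The
  term with \<open>\<bar>P - R\<bar>\<close> comes from the drift of the weights and has to be paid
  for by the other two parts of the barrier.\<close>

lemma corner_function:
  fixes a :: real
  assumes a: "4 \<le> a"
  shows "\<exists>f f1 f2 g. jet a f f1 f2 g \<and>
    (\<forall>s t. 0 \<le> f s t \<and> f s t \<le> ln (1 + a) / (8 * a) \<and>
       (let P = (sin s)\<^sup>2; R = (sin t)\<^sup>2 in
        g s t \<le> - (1 - 2 * (P + R) - \<bar>P - R\<bar> * \<bar>ln (1 + a * R) - ln (1 + a * P)\<bar> / 2) / 8 + (5 + ln (1 + a)) / (8 * a)))"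
proof -
  have a0: "0 < a" using a by simp
  define h where "h r = ln (1 + a * r)" for r
  define h1 where "h1 r = a / (1 + a * r)" for r
  define h2 where "h2 r = - a\<^sup>2 / (1 + a * r)\<^sup>2" for r
  have pos: "0 < 1 + a * (sin x)\<^sup>2" for x using a0 by (intro add_pos_nonneg) auto
  have h: "(h has_real_derivative h1 ((sin x)\<^sup>2)) (at ((sin x)\<^sup>2))" for x
    unfolding h_def h1_def using pos[of x] by (auto intro!: derivative_eq_intros)
  have h1: "(h1 has_real_derivative h2 ((sin x)\<^sup>2)) (at ((sin x)\<^sup>2))" for x
    unfolding h1_def h2_def using pos[of x] by (auto intro!: derivative_eq_intros simp: power2_eq_square)
  note jR = jet_comp[OF jet_sin_sq_snd[of a], of h h1 h2, OF h h1]
  note jP = jet_comp[OF jet_sin_sq_fst[of a], of h h1 h2, OF h h1]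
  note j\<alpha> = jet_add[OF jet_const[of a "1/2"] jet_cmult[OF jet_cos_prod[of a], of "1/2"]]
  note j\<beta> = jet_add[OF jet_const[of a "1/2"] jet_cmult[OF jet_cos_prod[of a], of "-1/2"]]
  note j = jet_add[OF jet_const[of a "ln (1 + a) / (8 * a)"]
             jet_cmult[OF jet_add[OF jet_mult[OF j\<alpha> jR] jet_mult[OF j\<beta> jP]], of "- 1 / (8 * a)"]]
  show ?thesis
  proof (rule exI, rule exI, rule exI, rule exI, rule conjI, rule j, rule allI, rule allI, goal_cases)
    case (1 s t)
    define P where "P = (sin s)\<^sup>2"
    define R where "R = (sin t)\<^sup>2"
    have P: "0 \<le> P" "P \<le> 1" and R: "0 \<le> R" "R \<le> 1" by (auto simp: P_def R_def abs_square_le_1)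
    define \<xi> where "\<xi> = cos s * cos t"
    have \<xi>: "\<bar>\<xi>\<bar> \<le> 1" unfolding \<xi>_def abs_mult by (intro mult_le_one) auto
    have \<xi>1: "\<xi> \<le> 1" "- \<xi> \<le> 1" using \<xi> by (auto simp: abs_le_iff)
    have \<xi>2: "1 - \<xi>\<^sup>2 \<le> P + R"
    proof -
      have "\<xi>\<^sup>2 = (1 - P) * (1 - R)" unfolding \<xi>_def power_mult_distrib cos_squared_eq P_def R_def ..
      then show ?thesis using mult_nonneg_nonneg[OF P(1) R(1)] by (simp add: algebra_simps)
    qed
    define \<alpha> where "\<alpha> = (1 + \<xi>) / 2"
    define \<beta> where "\<beta> = (1 - \<xi>) / 2"
    have ab: "0 \<le> \<alpha>" "0 \<le> \<beta>" "\<alpha> + \<beta> = 1" using \<xi>1 by (simp_all add: \<alpha>_def \<beta>_def field_simps)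
    define A where "A = h1 R * (2 - 4 * R + 2 * a * \<xi> * R) + h2 R * (4 * R * (1 - R))"
    define B where "B = h1 P * (2 - 4 * P + 2 * a * - \<xi> * P) + h2 P * (4 * P * (1 - P))"
    have A: "a * (1 - 2 * (1 - \<xi>)) - 1 \<le> A"
      using corner_log_bound[OF a0 R \<xi>1(1)] unfolding A_def h1_def h2_def .
    have B: "a * (1 - 2 * (1 + \<xi>)) - 1 \<le> B"
      using corner_log_bound[OF a0 P \<xi>1(2)] unfolding B_def h1_def h2_def by simp
    \<comment> \<open>The weighted mean of \<open>1 - 2 * (1 - \<xi>)\<close> and
      \<open>1 - 2 * (1 + \<xi>)\<close> is \<open>1 - 2 * (1 - \<xi>\<^sup>2)\<close>, which equals
      1 at the corners of both kinds.\<close>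
    have AB: "a * (1 - 2 * (P + R)) - 1 \<le> \<alpha> * A + \<beta> * B"
    proof -
      have "\<alpha> * (a * (1 - 2 * (1 - \<xi>)) - 1) + \<beta> * (a * (1 - 2 * (1 + \<xi>)) - 1) \<le> \<alpha> * A + \<beta> * B"
        using A B ab by (intro add_mono mult_left_mono) auto
      moreover have "\<alpha> * (a * (1 - 2 * (1 - \<xi>)) - 1) + \<beta> * (a * (1 - 2 * (1 + \<xi>)) - 1) = a * (1 - 2 * (1 - \<xi>\<^sup>2)) - 1"
        by (simp add: \<alpha>_def \<beta>_def power2_eq_square field_simps)
      moreover have "a * (1 - 2 * (P + R)) \<le> a * (1 - 2 * (1 - \<xi>\<^sup>2))"
        using \<xi>2 a0 by (intro mult_left_mono) auto
      ultimately show ?thesis by linarith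
    qed
    have hb: "0 \<le> h x" "h x \<le> ln (1 + a)" if x: "0 \<le> x" "x \<le> 1" for x
    proof -
      have "0 \<le> a * x" "a * x \<le> a" using x a0 mult_left_mono[OF x(2), of a] by auto
      then show "0 \<le> h x" "h x \<le> ln (1 + a)" unfolding h_def by auto
    qed
    define d where "d = h R - h P"
    have d: "\<bar>d\<bar> \<le> ln (1 + a)" using hb[OF P] hb[OF R] by (auto simp: d_def abs_le_iff)
    have L0: "0 \<le> ln (1 + a)" using a0 by (intro ln_ge_zero) auto
    have D: "- ln (1 + a) - a * (\<bar>P - R\<bar> * \<bar>d\<bar> / 2) \<le> (- 2 * \<xi> + a * (P - R)) / 2 * d"
    proof -
      have "- (\<xi> * d) \<ge> - ln (1 + a)"
        using mult_mono[OF \<xi> d] by (simp add: abs_mult[symmetric] abs_le_iff)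
      moreover have "a * ((P - R) * d / 2) \<ge> - (a * (\<bar>P - R\<bar> * \<bar>d\<bar> / 2))"
      proof -
        have "- (\<bar>P - R\<bar> * \<bar>d\<bar> / 2) \<le> (P - R) * d / 2"
          unfolding abs_mult[symmetric] by (simp add: abs_le_iff field_simps) 
        from mult_left_mono[OF this, of a] a0 show ?thesis by simp
      qed
      ultimately show ?thesis by (simp add: algebra_simps)
    qed
    have cr: "- 1 \<le> - \<eta> * (x * h1 x)" if "0 \<le> x" "\<bar>\<eta>\<bar> \<le> 1" for x \<eta>
    proof -
      have "0 \<le> a * x" using that a0 by simp
      then have "0 \<le> x * h1 x" "x * h1 x \<le> 1" by (auto simp: h1_def mult.commute[of x a] divide_le_eq_1)
      then have "\<bar>\<eta>\<bar> * \<bar>x * h1 x\<bar> \<le> 1 * 1" using that by (intro mult_mono) auto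
      then show ?thesis by (simp add: abs_mult[symmetric] abs_le_iff)
    qed
    define m where "m = \<alpha> * A + \<beta> * B + (- 2 * \<xi> + a * (P - R)) / 2 * d - 2 * \<xi> * (R * h1 R) + 2 * \<xi> * (P * h1 P)"
    \<comment> \<open>The 5 consists of 1 from the two logarithms and 2 from each of the two
      products of gradients of a weight and a logarithm.\<close>
    have m: "a * (1 - 2 * (P + R)) - a * (\<bar>P - R\<bar> * \<bar>d\<bar> / 2) - (5 + ln (1 + a)) \<le> m"
      using AB D cr[OF R(1) \<xi>] cr[OF P(1), of "- \<xi>"] \<xi> unfolding m_def by simp
    have gm: "(0 + - 1 / (8 * a) * (
        (1/2 + 1/2 * (cos s * cos t)) * (h1 R * (2 - 4 * R + 2 * a * cos s * cos t * R) + h2 R * (0\<^sup>2 + (2 * sin t * cos t)\<^sup>2))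
        + h R * (0 + 1/2 * (- 2 * cos s * cos t + a * (P - R)))
        + 2 * ((0 + 1/2 * (- sin s * cos t)) * (h1 R * 0) + (0 + 1/2 * (- cos s * sin t)) * (h1 R * (2 * sin t * cos t)))
      + ((1/2 + - 1/2 * (cos s * cos t)) * (h1 P * (2 - 4 * P - 2 * a * cos s * cos t * P) + h2 P * ((2 * sin s * cos s)\<^sup>2 + 0\<^sup>2))
        + h P * (0 + - 1/2 * (- 2 * cos s * cos t + a * (P - R)))
        + 2 * ((0 + - 1/2 * (- sin s * cos t)) * (h1 P * (2 * sin s * cos s)) + (0 + - 1/2 * (- cos s * sin t)) * (h1 P * 0)))))
      = - m / (8 * a)"
    proof -
      have sc: "(2 * sin x * cos x)\<^sup>2 = 4 * (sin x)\<^sup>2 * (1 - (sin x)\<^sup>2)" for x :: real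
        by (simp add: power_mult_distrib cos_squared_eq)
      have R': "sin t * sin t = R" and P': "sin s * sin s = P" by (simp_all add: P_def R_def power2_eq_square)
      have c1: "(0 + 1/2 * (- cos s * sin t)) * (h1 R * (2 * sin t * cos t)) = - \<xi> * (R * h1 R)"
        unfolding R'[symmetric] \<xi>_def by (simp add: algebra_simps)
      have c2: "(0 + - 1/2 * (- sin s * cos t)) * (h1 P * (2 * sin s * cos s)) = \<xi> * (P * h1 P)"
        unfolding P'[symmetric] \<xi>_def by (simp add: algebra_simps)
      have c3: "h1 R * (2 - 4 * R + 2 * a * cos s * cos t * R) + h2 R * (0\<^sup>2 + (2 * sin t * cos t)\<^sup>2) = A"
        unfolding A_def sc R_def[symmetric] by (simp add: \<xi>_def)
      have c4: "h1 P * (2 - 4 * P - 2 * a * cos s * cos t * P) + h2 P * ((2 * sin s * cos s)\<^sup>2 + 0\<^sup>2) = B"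
        unfolding B_def sc P_def[symmetric] by (simp add: \<xi>_def)
      show ?thesis unfolding c1 c2 c3 c4 m_def d_def \<alpha>_def \<beta>_def
        by (simp add: \<xi>_def algebra_simps add_divide_distrib diff_divide_distrib)
    qed
    have fin: "- m / (8 * a) \<le> - (1 - 2 * (P + R) - \<bar>P - R\<bar> * \<bar>d\<bar> / 2) / 8 + (5 + ln (1 + a)) / (8 * a)"
    proof -
      have "- m / (8 * a) \<le> - (a * (1 - 2 * (P + R)) - a * (\<bar>P - R\<bar> * \<bar>d\<bar> / 2) - (5 + ln (1 + a))) / (8 * a)"
        using m a0 by (intro divide_right_mono) auto
      also have "\<dots> = - (1 - 2 * (P + R) - \<bar>P - R\<bar> * \<bar>d\<bar> / 2) / 8 + (5 + ln (1 + a)) / (8 * a)"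
        using a0 by (simp add: field_simps)
      finally show ?thesis .
    qed
    have fb: "0 \<le> \<alpha> * h R + \<beta> * h P" "\<alpha> * h R + \<beta> * h P \<le> ln (1 + a)"
    proof -
      show "0 \<le> \<alpha> * h R + \<beta> * h P" using ab hb P R by simp
      have "\<alpha> * h R + \<beta> * h P \<le> \<alpha> * ln (1 + a) + \<beta> * ln (1 + a)"
        using ab hb P R by (intro add_mono mult_left_mono) auto
      then show "\<alpha> * h R + \<beta> * h P \<le> ln (1 + a)" using ab by (simp add: distrib_right[symmetric])
    qed
    have feq: "ln (1 + a) / (8 * a) + - 1 / (8 * a) * ((1/2 + 1/2 * (cos s * cos t)) * h R + (1/2 + - 1/2 * (cos s * cos t)) * h P)
       = (ln (1 + a) - (\<alpha> * h R + \<beta> * h P)) / (8 * a)"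
    proof -
      have "1/2 + 1/2 * (cos s * cos t) = \<alpha>" "1/2 + - 1/2 * (cos s * cos t) = \<beta>"
        by (simp_all add: \<alpha>_def \<beta>_def \<xi>_def field_simps)
      then show ?thesis by (simp add: diff_divide_distrib)
    qed
    have fb': "0 \<le> (ln (1 + a) - (\<alpha> * h R + \<beta> * h P)) / (8 * a)"
       "(ln (1 + a) - (\<alpha> * h R + \<beta> * h P)) / (8 * a) \<le> ln (1 + a) / (8 * a)"
      using fb a0 by (auto intro!: divide_right_mono)
    show ?case using fb' fin
      unfolding Let_def P_def[symmetric] R_def[symmetric] feq gm d_def h_def[symmetric] by blast
  qed
qed

section \<open>The barrier for one column\<close>

text \<open>The bound is free of \<open>a\<close> and makes the loss of the corner term comparable
  to the gain of the interior function. As \<open>P\<close> and \<open>R\<close> are at most 1, the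
  ratio of the two arguments is at most \<open>1 / (P * R)\<close>; then
  \<open>ln z \<le> z - 1\<close> is applied to the square root.\<close>

lemma log_ratio_bound:
  fixes a P R :: real
  assumes a: "0 < a" and P: "0 < P" "P \<le> 1" and R: "0 < R" "R \<le> 1"
  shows "ln (1 + a * P) - ln (1 + a * R) \<le> 2 / sqrt (P * R)"
proof -
  have p: "0 < 1 + a * P" "0 < 1 + a * R" using a P R by (auto intro: add_pos_pos)
  have q: "0 < P * R" using P R by simp
  have "P * R * (1 + a * P) \<le> 1 + a * R"
  proof -
    have "P * R \<le> 1" using P R by (auto simp: mult_le_one)
    moreover have "(a * R) * (P * P) \<le> (a * R) * 1" using P R a by (intro mult_left_mono) (auto simp: mult_le_one)
    ultimately show ?thesis by (simp add: algebra_simps)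
  qed
  then have "(1 + a * P) / (1 + a * R) \<le> 1 / (P * R)" using p q P R by (simp add: field_simps)
  then have "ln ((1 + a * P) / (1 + a * R)) \<le> ln (1 / (P * R))" using p q by (intro ln_mono) auto
  also have "1 / (P * R) = (1 / sqrt (P * R))\<^sup>2" using q by (simp add: power_divide)
  also have "ln \<dots> = 2 * ln (1 / sqrt (P * R))" using q by (subst ln_realpow) auto
  also have "\<dots> \<le> 2 * (1 / sqrt (P * R) - 1)" using ln_le_minus_one[of "1 / sqrt (P * R)"] q by (intro mult_left_mono) auto
  finally show ?thesis using p by (simp add: ln_div)
qed

text \<open>\<open>gf\<close>, \<open>ge\<close>, \<open>gc\<close> are the images of the interior,
  layer and corner functions. For \<open>3 \<le> a * (P * R)\<close> the interior function gains
  \<open>y = (P + R) / sqrt (P * R + 1 / a)\<close>, and the corner function loses at most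
  \<open>3/4 * y\<close>. In the layer, \<open>K = 6 / F\<close> makes the layer function gain
  \<open>6 * (\<epsilon> * a) * (P + R)\<close>, of which 5 parts pay for the interior function and
  1 for the corner function. There remains the \<open>- 1/8\<close> of the corner function, half of
  which covers the small errors.\<close>

lemma barrier_pointwise:
  fixes a \<epsilon> F C K P R gf ge gc :: real
  assumes a: "4 \<le> a" and F: "0 < F" and K: "K = 6 / F" and \<epsilon>: "0 \<le> \<epsilon>"
    and P: "0 \<le> P" "P \<le> 1" and R: "0 \<le> R" "R \<le> 1"
    and small: "K * C * \<epsilon> + (5 + ln (1 + a)) / (8 * a) \<le> 1/16"
    and big: "(2 + ln (1 + a) / 2) / 8 \<le> \<epsilon> * a"
    and gf: "3 \<le> a * (P * R) \<longrightarrow> gf \<le> - ((P + R) / sqrt (P * R + 1 / a))" "gf \<le> 5 * (\<epsilon> * a) * (P + R)"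
    and ge: "- C \<le> ge" "a * (P * R) \<le> 3 \<longrightarrow> F * (a * (P + R)) - C \<le> ge"
    and gc: "gc \<le> - (1 - 2 * (P + R) - \<bar>P - R\<bar> * \<bar>ln (1 + a * R) - ln (1 + a * P)\<bar> / 2) / 8 + (5 + ln (1 + a)) / (8 * a)"
  shows "gf + - (K * \<epsilon>) * ge + gc \<le> - 1/16"
proof -
  have K0: "0 < K" using K F by simp
  define d where "d = \<bar>ln (1 + a * R) - ln (1 + a * P)\<bar>"
  have PR: "\<bar>P - R\<bar> \<le> P + R" using P R by auto
  have d0: "0 \<le> d" by (simp add: d_def)
  show ?thesis
  proof (cases "3 \<le> a * (P * R)")
    case True
    have a0: "0 < a" using a by simp
    have q: "0 < P * R" using True a0 by (smt (verit) mult_nonneg_nonpos mult_nonneg_nonneg P R)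
    then have P0: "0 < P" and R0: "0 < R" using P R by (auto simp: zero_less_mult_iff)
    have q1: "P * R \<le> 1" using P R by (simp add: mult_le_one)
    define \<sigma> where "\<sigma> = sqrt (P * R)"
    have \<sigma>: "0 < \<sigma>" "\<sigma> \<le> 1" using q q1 by (auto simp: \<sigma>_def)
    have d: "d \<le> 2 / \<sigma>"
      using log_ratio_bound[OF a0 P0 P(2) R0 R(2)] log_ratio_bound[OF a0 R0 R(2) P0 P(2)]
      unfolding d_def \<sigma>_def by (auto simp: abs_le_iff mult.commute)
    have "\<bar>P - R\<bar> * d / 2 \<le> (P + R) * (2 / \<sigma>) / 2"
      using PR d d0 P R by (intro divide_right_mono mult_mono) auto
    moreover have "x * (2 / \<sigma>) / 2 = x / \<sigma>" for x :: real by simp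
    ultimately have 1: "\<bar>P - R\<bar> * d / 2 \<le> (P + R) / \<sigma>" by metis
    have 2: "P + R \<le> (P + R) / \<sigma>" 
    proof -
      have "(P + R) * \<sigma> \<le> (P + R) * 1" using \<sigma> P R by (intro mult_left_mono) auto
      then show ?thesis using \<sigma> by (simp add: le_divide_eq)
    qed
    have 3: "(P + R) / \<sigma> \<le> 2 * ((P + R) / sqrt (P * R + 1 / a))"
    proof -
      have "sqrt (P * R + 1 / a) \<le> sqrt (4 * (P * R))"
        using True a0 by (intro real_sqrt_le_mono) (simp add: field_simps)
      also have "\<dots> = 2 * \<sigma>" by (simp add: \<sigma>_def real_sqrt_mult)
      finally have "sqrt (P * R + 1 / a) \<le> 2 * \<sigma>" .
      moreover have "0 < sqrt (P * R + 1 / a)" using q a0 by (simp add: add_pos_pos)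
      ultimately have "(P + R) / (2 * \<sigma>) \<le> (P + R) / sqrt (P * R + 1 / a)"
        using P R \<sigma> by (intro divide_left_mono) auto
      then show ?thesis using \<sigma> by (simp add: field_simps)
    qed
    have 4: "- (K * \<epsilon>) * ge \<le> K * C * \<epsilon>"
      using mult_left_mono[OF ge(1), of "K * \<epsilon>"] K0 \<epsilon> by (simp add: algebra_simps)
    have 5: "0 \<le> (P + R) / \<sigma>" using P R \<sigma> by simp
    define x where "x = (P + R) / \<sigma>"
    define y where "y = (P + R) / sqrt (P * R + 1 / a)"
    define z where "z = \<bar>P - R\<bar> * d / 2"
    show ?thesis using gf(1) True gc 1 2 3 4 5 small
      unfolding d_def[symmetric] x_def[symmetric] y_def[symmetric] z_def[symmetric] by argo
  next
    case False
    have L: "d \<le> ln (1 + a)"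
    proof -
      have "0 \<le> ln (1 + a * x)" "ln (1 + a * x) \<le> ln (1 + a)" if "0 \<le> x" "x \<le> 1" for x
      proof -
        have "0 \<le> a * x" "a * x \<le> a" using that a mult_left_mono[OF that(2), of a] by auto
        then show "0 \<le> ln (1 + a * x)" "ln (1 + a * x) \<le> ln (1 + a)" by auto
      qed
      from this[OF P] this[OF R] show ?thesis unfolding d_def by linarith
    qed
    have "\<bar>P - R\<bar> * d / 2 \<le> (P + R) * ln (1 + a) / 2"
      using PR L d0 P R by (intro divide_right_mono mult_mono) auto
    then have 1: "2 * (P + R) + \<bar>P - R\<bar> * d / 2 \<le> (P + R) * (2 + ln (1 + a) / 2)" by (simp add: algebra_simps)
    have 2: "(P + R) * ((2 + ln (1 + a) / 2) / 8) \<le> (P + R) * (\<epsilon> * a)"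
      using big P R by (intro mult_left_mono) auto
    have "K * \<epsilon> * (F * (a * (P + R)) - C) \<le> K * \<epsilon> * ge"
      using ge(2) False K0 \<epsilon> by (intro mult_left_mono) auto
    moreover have "K * \<epsilon> * (F * (a * (P + R)) - C) = 6 * (\<epsilon> * a) * (P + R) - K * C * \<epsilon>"
      using F by (simp add: K algebra_simps)
    moreover have "- (K * \<epsilon>) * ge = - (K * \<epsilon> * ge)" by simp
    ultimately have 3: "- (K * \<epsilon>) * ge \<le> K * C * \<epsilon> - 6 * (\<epsilon> * a) * (P + R)"
      by (simp only:)
    have e: "gc \<le> - 1 / 8 + (2 * (P + R) + \<bar>P - R\<bar> * d / 2) / 8 + (5 + ln (1 + a)) / (8 * a)"
      using gc unfolding d_def[symmetric] by argo
    have "(2 * (P + R) + \<bar>P - R\<bar> * d / 2) / 8 \<le> (\<epsilon> * a) * (P + R)"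
      using 1 2 by (simp add: mult.commute)
    moreover have "5 * (\<epsilon> * a) * (P + R) + (\<epsilon> * a) * (P + R) - 6 * (\<epsilon> * a) * (P + R) = 0"
      by (simp add: algebra_simps)
    ultimately show ?thesis using gf(2) 3 e small by argo
  qed
qed

lemma cell_barrier:
  obtains C a0 :: real where "0 < C"
    "\<And>a. a0 \<le> a \<Longrightarrow> \<exists>u u1 u2 g. jet a u u1 u2 g \<and>
       (\<forall>s t. \<bar>s\<bar> \<le> pi \<longrightarrow> 0 \<le> u s t \<and> u s t \<le> C \<and> g s t \<le> - 1/16 \<and>
          (s = 0 \<longrightarrow> u s t \<le> C * (ln a / sqrt a)))"
proof -
  obtain F C M :: real where F: "0 < F" and C: "0 \<le> C"
    and layer: "\<And>a. 4 \<le> a \<Longrightarrow> \<exists>e e1 e2 g. jet a e e1 e2 g \<and>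
       (\<forall>s t. \<bar>s\<bar> \<le> pi \<longrightarrow> 0 \<le> e s t \<and> e s t \<le> M \<and> - C \<le> g s t \<and>
          (a * ((sin s)\<^sup>2 * (sin t)\<^sup>2) \<le> 3 \<longrightarrow> F * (a * ((sin s)\<^sup>2 + (sin t)\<^sup>2)) - C \<le> g s t))"
    using layer_function by blast
  define K where "K = 6 / F"
  define \<epsilon> where "\<epsilon> a = (3 + ln a / 2) / sqrt a" for a :: real
  have lim: "((\<lambda>a. K * C * \<epsilon> a + (5 + ln (1 + a)) / (8 * a)) \<longlongrightarrow> K * C * 0 + 0) at_top"
    unfolding \<epsilon>_def by (intro tendsto_intros; real_asymp)
  \<comment> \<open>As \<open>\<epsilon> a\<close> has order \<open>ln a / sqrt a\<close>,
    \<open>\<epsilon> a * ln (1 + a)\<close> tends to 0 while \<open>\<epsilon> a * a\<close>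
    outgrows the logarithm.\<close>
  have "\<forall>\<^sub>F a in at_top. 4 \<le> a \<and> \<epsilon> a * ln (1 + a) \<le> 1 \<and> (2 + ln (1 + a) / 2) / 8 \<le> \<epsilon> a * a
      \<and> \<epsilon> a \<le> ln a / sqrt a \<and> ln (1 + a) / (8 * a) \<le> \<epsilon> a \<and> \<epsilon> a \<le> 1
      \<and> K * C * \<epsilon> a + (5 + ln (1 + a)) / (8 * a) \<le> 1/16"
  proof (intro eventually_conj)
    show "\<forall>\<^sub>F a in at_top. K * C * \<epsilon> a + (5 + ln (1 + a)) / (8 * a) \<le> 1/16"
      using order_tendstoD(2)[OF lim, of "1/16"] by (auto elim: eventually_mono)
  qed (unfold \<epsilon>_def, real_asymp+)
  then obtain a0 where a0: "\<And>a. a0 \<le> a \<Longrightarrow> 4 \<le> a \<and> \<epsilon> a * ln (1 + a) \<le> 1 \<and> (2 + ln (1 + a) / 2) / 8 \<le> \<epsilon> a * a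
      \<and> \<epsilon> a \<le> ln a / sqrt a \<and> ln (1 + a) / (8 * a) \<le> \<epsilon> a \<and> \<epsilon> a \<le> 1
      \<and> K * C * \<epsilon> a + (5 + ln (1 + a)) / (8 * a) \<le> 1/16"
    unfolding eventually_at_top_linorder by blast
  have K0: "0 < K" using F by (simp add: K_def)
  show thesis
  \<comment> \<open>The 9 is 7 from the interior profile and 1 each for
    \<open>\<epsilon> a * ln (1 + a)\<close> and the corner function. The absolute value makes the
    constant positive before \<open>0 \<le> M\<close> is known.\<close>
  proof (rule that[of "9 + K * \<bar>M\<bar>" a0])
    show "0 < 9 + K * \<bar>M\<bar>" using K0 by (intro add_pos_nonneg) auto
    fix a assume "a0 \<le> a"
    from a0[OF this] have a: "4 \<le> a" and e1: "\<epsilon> a * ln (1 + a) \<le> 1" and e2: "(2 + ln (1 + a) / 2) / 8 \<le> \<epsilon> a * a"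
      and e3: "\<epsilon> a \<le> ln a / sqrt a" and e4: "ln (1 + a) / (8 * a) \<le> \<epsilon> a" and e5: "\<epsilon> a \<le> 1"
      and e6: "K * C * \<epsilon> a + (5 + ln (1 + a)) / (8 * a) \<le> 1/16" by auto
    have \<epsilon>0: "0 \<le> \<epsilon> a"
    proof -
      have "0 \<le> ln (1 + a) / (8 * a)" using a by simp
      then show ?thesis using e4 by linarith
    qed
    obtain e ee1 ee2 ge where je: "jet a e ee1 ee2 ge"
      and e: "\<And>s t. \<bar>s\<bar> \<le> pi \<Longrightarrow> 0 \<le> e s t \<and> e s t \<le> M \<and> - C \<le> ge s t \<and>
          (a * ((sin s)\<^sup>2 * (sin t)\<^sup>2) \<le> 3 \<longrightarrow> F * (a * ((sin s)\<^sup>2 + (sin t)\<^sup>2)) - C \<le> ge s t)"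
      using layer[OF a] by blast
    obtain f f1 f2 gf where jf: "jet a f f1 f2 gf"
      and f: "\<And>s t. 0 \<le> f s t \<and> f s t \<le> 7 + \<epsilon> a * ln (1 + a) \<and> (sin s = 0 \<longrightarrow> f s t = \<epsilon> a) \<and>
       (let P = (sin s)\<^sup>2; R = (sin t)\<^sup>2 in
        (3 \<le> a * (P * R) \<longrightarrow> gf s t \<le> - ((P + R) / sqrt (P * R + 1 / a))) \<and> gf s t \<le> 5 * (\<epsilon> a * a) * (P + R))"
      using interior_function[OF a, folded \<epsilon>_def] by blast
    obtain c c1 c2 gc where jc: "jet a c c1 c2 gc"
      and c: "\<And>s t. 0 \<le> c s t \<and> c s t \<le> ln (1 + a) / (8 * a) \<and>
       (let P = (sin s)\<^sup>2; R = (sin t)\<^sup>2 in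
        gc s t \<le> - (1 - 2 * (P + R) - \<bar>P - R\<bar> * \<bar>ln (1 + a * R) - ln (1 + a * P)\<bar> / 2) / 8 + (5 + ln (1 + a)) / (8 * a))"
      using corner_function[OF a] by blast
    \<comment> \<open>The layer function enters as \<open>K * \<epsilon> a * (M - e)\<close>, which
      is nonnegative and of order \<open>\<epsilon> a\<close> everywhere, in particular on
      \<open>s = 0\<close>.\<close>
    note j = jet_add[OF jet_add[OF jf jet_add[OF jet_const[of a "K * \<epsilon> a * M"] jet_cmult[OF je, of "- (K * \<epsilon> a)"]]] jc]
    show "\<exists>u u1 u2 g. jet a u u1 u2 g \<and>
       (\<forall>s t. \<bar>s\<bar> \<le> pi \<longrightarrow> 0 \<le> u s t \<and> u s t \<le> 9 + K * \<bar>M\<bar> \<and> g s t \<le> - 1/16 \<and>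
          (s = 0 \<longrightarrow> u s t \<le> (9 + K * \<bar>M\<bar>) * (ln a / sqrt a)))"
    proof (rule exI, rule exI, rule exI, rule exI, rule conjI, rule j, rule allI, rule allI, rule impI, goal_cases)
      case (1 s t)
      note es = e[OF 1, of t]
      have fs: "0 \<le> f s t" "f s t \<le> 7 + \<epsilon> a * ln (1 + a)" "sin s = 0 \<Longrightarrow> f s t = \<epsilon> a"
        using f[of s t] by blast+
      have cs: "0 \<le> c s t" "c s t \<le> ln (1 + a) / (8 * a)" using c[of s t] by blast+
      have M0: "0 \<le> M" using es by auto
      define E where "E = K * \<epsilon> a * M + - (K * \<epsilon> a) * e s t"
      have E_eq: "E = K * \<epsilon> a * (M - e s t)" by (simp add: E_def algebra_simps)
      have E0: "0 \<le> E" unfolding E_eq using es K0 \<epsilon>0 by simp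
      have E1: "E \<le> K * M * \<epsilon> a"
        unfolding E_eq using es K0 \<epsilon>0 mult_left_mono[of "M - e s t" M "K * \<epsilon> a"] by (simp add: algebra_simps)
      have KM: "K * M * \<epsilon> a \<le> K * M" using K0 M0 e5 by (simp add: mult_left_le)
      have g: "gf s t + - (K * \<epsilon> a) * ge s t + gc s t \<le> - 1/16"
      proof (rule barrier_pointwise[OF a F K_def \<epsilon>0 _ _ _ _ e6 e2])
        show "0 \<le> (sin s)\<^sup>2" "(sin s)\<^sup>2 \<le> 1" "0 \<le> (sin t)\<^sup>2" "(sin t)\<^sup>2 \<le> 1"
          by (auto simp: abs_square_le_1)
      qed (use f[of s t] c[of s t] es in \<open>unfold Let_def, blast+\<close>)
      have z: "f s t + E + c s t \<le> (9 + K * M) * (ln a / sqrt a)" if "s = 0"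
      proof -
        have "f s t = \<epsilon> a" using fs(3) that by simp
        then have "f s t + E + c s t \<le> \<epsilon> a + K * M * \<epsilon> a + \<epsilon> a" using E1 cs e4 by linarith
        also have "\<dots> = (2 + K * M) * \<epsilon> a" by (simp add: algebra_simps)
        also have "\<dots> \<le> (9 + K * M) * (ln a / sqrt a)"
          using e3 \<epsilon>0 K0 M0 by (intro mult_mono) auto
        finally show ?thesis .
      qed
      have "0 \<le> f s t + E + c s t" using fs cs E0 by linarith
      moreover have "f s t + E + c s t \<le> 9 + K * M" using fs cs E1 KM e1 e4 e5 by linarith
      ultimately show ?case using g z M0 unfolding E_def[symmetric] by simp
    qed
  qed
qed

section \<open>Maximum principle and upper bound\<close>

lemma second_derivative_local_max:
  fixes f f' :: "real \<Rightarrow> real"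
  assumes d: "0 < d"
    and f: "\<And>x. \<bar>x - x0\<bar> < d \<Longrightarrow> (f has_real_derivative f' x) (at x)"
    and f': "(f' has_real_derivative c) (at x0)"
    and max: "\<And>x. \<bar>x - x0\<bar> < d \<Longrightarrow> f x \<le> f x0"
  shows "f' x0 = 0" "c \<le> 0"
proof -
  show z: "f' x0 = 0"
    using DERIV_local_max[OF f[of x0] d] max d by (simp add: abs_minus_commute)
  show "c \<le> 0"
  proof (rule ccontr)
    assume "\<not> c \<le> 0"
    then obtain e where e: "0 < e" "\<And>h. 0 < h \<Longrightarrow> h < e \<Longrightarrow> f' x0 < f' (x0 + h)"
      using DERIV_pos_inc_right[OF f'] by auto
    define h where "h = min d e / 2"
    have h: "0 < h" "h < d" "h < e" using d e by (auto simp: h_def)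
    obtain x where x: "x0 < x" "x < x0 + h" "f (x0 + h) - f x0 = h * f' x"
      using MVT2[of x0 "x0 + h" f f'] f h by auto
    have "0 < f' x" using e(2)[of "x - x0"] x h z by simp
    then have "0 < h * f' x" using h by simp
    then show False using max[of "x0 + h"] h x by simp
  qed
qed

lemma interior_max_2d:
  fixes D :: "real \<times> real \<Rightarrow> real"
  assumes U: "open U" "(x0, y0) \<in> U"
    and max: "\<And>p. p \<in> U \<Longrightarrow> D p \<le> D (x0, y0)"
    and der: "\<And>x y. (x, y) \<in> U \<Longrightarrow> ((\<lambda>x. D (x, y)) has_real_derivative D1 x y) (at x)"
      "\<And>x y. (x, y) \<in> U \<Longrightarrow> ((\<lambda>y. D (x, y)) has_real_derivative D2 x y) (at y)"
      "((\<lambda>x. D1 x y0) has_real_derivative c1) (at x0)"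
      "((\<lambda>y. D2 x0 y) has_real_derivative c2) (at y0)"
  shows "D1 x0 y0 = 0" "D2 x0 y0 = 0" "c1 \<le> 0" "c2 \<le> 0"
proof -
  obtain d where d: "0 < d" "ball (x0, y0) d \<subseteq> U"
    using U open_contains_ball by blast
  have u: "(x, y0) \<in> U" if "\<bar>x - x0\<bar> < d" for x
    using d that by (auto intro!: subsetD[OF d(2)] simp: dist_Pair_Pair dist_real_def abs_minus_commute)
  have v: "(x0, y) \<in> U" if "\<bar>y - y0\<bar> < d" for y
    using d that by (auto intro!: subsetD[OF d(2)] simp: dist_Pair_Pair dist_real_def abs_minus_commute)
  show "D1 x0 y0 = 0" "c1 \<le> 0"
    using second_derivative_local_max[OF d(1), of x0 "\<lambda>x. D (x, y0)" "\<lambda>x. D1 x y0" c1] u max der by blast+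
  show "D2 x0 y0 = 0" "c2 \<le> 0"
    using second_derivative_local_max[OF d(1), of y0 "\<lambda>y. D (x0, y)" "\<lambda>y. D2 x0 y" c2] v max der by blast+
qed

text \<open>Strictness in \<open>sub\<close> excludes an interior maximum at once, since there the
  first derivatives vanish and the pure second derivatives are at most 0.\<close>

lemma maximum_principle:
  fixes D :: "real \<times> real \<Rightarrow> real"
  assumes K: "compact K" "continuous_on K D" and U: "open U" "U \<subseteq> K"
    and bd: "\<And>p. p \<in> K - U \<Longrightarrow> D p \<le> 0"
    and der: "\<And>x y. (x, y) \<in> U \<Longrightarrow> ((\<lambda>x. D (x, y)) has_real_derivative D1 x y) (at x)"
      "\<And>x y. (x, y) \<in> U \<Longrightarrow> ((\<lambda>y. D (x, y)) has_real_derivative D2 x y) (at y)"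
      "\<And>x y. (x, y) \<in> U \<Longrightarrow> ((\<lambda>x. D1 x y) has_real_derivative D11 x y) (at x)"
      "\<And>x y. (x, y) \<in> U \<Longrightarrow> ((\<lambda>y. D2 x y) has_real_derivative D22 x y) (at y)"
    and sub: "\<And>x y. (x, y) \<in> U \<Longrightarrow> 0 < D11 x y + D22 x y + b1 x y * D1 x y + b2 x y * D2 x y"
    and p: "p \<in> K"
  shows "D p \<le> 0"
proof -
  obtain m where m: "m \<in> K" "\<And>p. p \<in> K \<Longrightarrow> D p \<le> D m"
    using continuous_attains_sup[OF K(1) _ K(2)] p by blast
  have "m \<notin> U"
  proof
    assume mU: "m \<in> U"
    obtain x y where xy: "m = (x, y)" by (cases m)
    have "D1 x y = 0" "D2 x y = 0" "D11 x y \<le> 0" "D22 x y \<le> 0"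
      using interior_max_2d[OF U(1), of x y D D1 D2 "D11 x y" "D22 x y"] mU m U der unfolding xy by blast+
    then show False using sub[of x y] mU xy by simp
  qed
  then have "D m \<le> 0" using bd m(1) by blast
  then show ?thesis using m(2)[OF p] by linarith
qed

text \<open>At a maximum point of \<open>\<psi> / \<phi>\<close> on the set
  \<open>1/2 \<le> h\<close> within one cell, \<open>lam * \<psi>\<close> is at most minus the
  Laplacian of \<open>\<psi>\<close>. For \<open>h - 1/2\<close> itself the quotient of these two
  would be unbounded near the edge of the set; for its square, the gradient term makes minus the
  Laplacian negative there.\<close>

lemma eigenvalue_upper_bound:
  assumes pe: "principal_eigenpair L A lam \<phi>" and L: "2 \<le> L"
  shows "lam \<le> 32 * pi\<^sup>2"
proof -
  obtain \<phi>1 \<phi>2 \<phi>11 \<phi>22 where cont: "continuous_on (sq_closed L) \<phi>"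
    and pos: "\<And>p. p \<in> sq_open L \<Longrightarrow> 0 < \<phi> p"
    and eq: "\<And>x y. (x, y) \<in> sq_open L \<Longrightarrow>
           ((\<lambda>t. \<phi> (t, y)) has_real_derivative \<phi>1 (x, y)) (at x) \<and>
           ((\<lambda>t. \<phi> (x, t)) has_real_derivative \<phi>2 (x, y)) (at y) \<and>
           ((\<lambda>t. \<phi>1 (t, y)) has_real_derivative \<phi>11 (x, y)) (at x) \<and>
           ((\<lambda>t. \<phi>2 (x, t)) has_real_derivative \<phi>22 (x, y)) (at y) \<and>
           - (\<phi>11 (x, y) + \<phi>22 (x, y))
             + A * (v1 x y * \<phi>1 (x, y) + v2 x y * \<phi>2 (x, y))
           = lam * \<phi> (x, y)"
    using pe unfolding principal_eigenpair_def by fast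
  define h where "h p = sin (pi * fst p) * sin (pi * snd p)" for p :: "real \<times> real"
  define \<psi> where "\<psi> p = (h p - 1/2)\<^sup>2" for p
  define K where "K = ({0..1} \<times> {0..1}) \<inter> {p. 1/2 \<le> h p}"
  define U where "U = ({0<..<1} \<times> {0<..<1}) \<inter> {p. 1/2 < h p}"
  have hc: "continuous_on S h" for S unfolding h_def by (intro continuous_intros)
  have "compact K" unfolding K_def
    by (intro compact_Int_closed compact_Times closed_Collect_le hc continuous_intros) auto
  have Ko: "x \<in> {0<..<1} \<and> y \<in> {0<..<1}" if "(x, y) \<in> K" for x y
    using that by (auto simp: K_def h_def less_le)
  have KL: "K \<subseteq> sq_open L"
  proof
    fix p assume "p \<in> K"
    then show "p \<in> sq_open L" using Ko[of "fst p" "snd p"] L by (auto simp: sq_open_def)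
  qed
  have cK: "continuous_on K (\<lambda>p. \<psi> p / \<phi> p)"
    unfolding \<psi>_def using KL pos
    by (intro continuous_intros hc continuous_on_subset[OF cont])
       (force simp: sq_open_def sq_closed_def)+
  have mid: "(1/2, 1/2) \<in> K" by (simp add: K_def h_def)
  obtain p where p: "p \<in> K" "\<And>q. q \<in> K \<Longrightarrow> \<psi> q / \<phi> q \<le> \<psi> p / \<phi> p"
    using continuous_attains_sup[OF \<open>compact K\<close> _ cK] mid by blast
  obtain x y where xy: "p = (x, y)" by (cases p)
  define t where "t = \<psi> p / \<phi> p"
  have \<phi>K: "0 < \<phi> q" if "q \<in> K" for q using pos KL that by blast
  have "0 < \<psi> (1/2, 1/2) / \<phi> (1/2, 1/2)" using \<phi>K[OF mid] by (simp add: \<psi>_def h_def)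
  then have t: "0 < t" using p(2)[OF mid] by (simp add: t_def)
  have "h p \<noteq> 1/2" using t unfolding t_def \<psi>_def by (metis diff_self div_0 less_irrefl zero_power2)
  then have pU: "(x, y) \<in> U" using p(1) Ko[of x y] unfolding xy by (auto simp: U_def K_def less_le)
  have UK: "U \<subseteq> K" by (auto simp: U_def K_def)
  have oU: "open U" unfolding U_def by (intro open_Int open_Times open_Collect_less hc continuous_intros) auto
  define D where "D q = \<psi> q - t * \<phi> q" for q
  have D0: "D p = 0" using \<phi>K[OF p(1)] by (simp add: D_def t_def)
  have Dle: "D q \<le> D (x, y)" if "q \<in> U" for q
  proof -
    have "\<psi> q / \<phi> q \<le> t" using p(2)[OF subsetD[OF UK that]] by (simp add: t_def)
    then have "\<psi> q \<le> t * \<phi> q" using \<phi>K[of q] UK that by (auto simp: divide_le_eq)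
    then show ?thesis using D0 by (simp add: D_def xy)
  qed
  define d where "d x y = h (x, y) - 1/2" for x y
  define \<psi>1 where "\<psi>1 x y = 2 * d x y * (pi * cos (pi * x) * sin (pi * y))" for x y
  define \<psi>2 where "\<psi>2 x y = 2 * d x y * (pi * sin (pi * x) * cos (pi * y))" for x y
  define \<psi>11 where "\<psi>11 x y = 2 * (pi * cos (pi * x) * sin (pi * y))\<^sup>2 - 2 * d x y * (pi\<^sup>2 * h (x, y))" for x y
  define \<psi>22 where "\<psi>22 x y = 2 * (pi * sin (pi * x) * cos (pi * y))\<^sup>2 - 2 * d x y * (pi\<^sup>2 * h (x, y))" for x y
  have der: "((\<lambda>x. \<psi> (x, y)) has_real_derivative \<psi>1 x y) (at x)"
    "((\<lambda>y. \<psi> (x, y)) has_real_derivative \<psi>2 x y) (at y)"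
    "((\<lambda>x. \<psi>1 x y) has_real_derivative \<psi>11 x y) (at x)"
    "((\<lambda>y. \<psi>2 x y) has_real_derivative \<psi>22 x y) (at y)" for x y
    unfolding \<psi>_def \<psi>1_def \<psi>2_def \<psi>11_def \<psi>22_def d_def h_def
    by (auto intro!: derivative_eq_intros simp: power2_eq_square algebra_simps)
  note e = eq[OF subsetD[OF KL subsetD[OF UK]]]
  have crit: "\<psi>1 x y - t * \<phi>1 (x, y) = 0" "\<psi>2 x y - t * \<phi>2 (x, y) = 0"
    "\<psi>11 x y - t * \<phi>11 (x, y) \<le> 0" "\<psi>22 x y - t * \<phi>22 (x, y) \<le> 0"
  proof -
    have 1: "((\<lambda>x. D (x, y)) has_real_derivative \<psi>1 x y - t * \<phi>1 (x, y)) (at x)" if "(x, y) \<in> U" for x y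
      unfolding D_def using e[OF that] by (intro DERIV_diff DERIV_cmult der) auto
    have 2: "((\<lambda>y. D (x, y)) has_real_derivative \<psi>2 x y - t * \<phi>2 (x, y)) (at y)" if "(x, y) \<in> U" for x y
      unfolding D_def using e[OF that] by (intro DERIV_diff DERIV_cmult der) auto
    have 3: "((\<lambda>x. \<psi>1 x y - t * \<phi>1 (x, y)) has_real_derivative \<psi>11 x y - t * \<phi>11 (x, y)) (at x)"
      using e[OF pU] by (intro DERIV_diff DERIV_cmult der) auto
    have 4: "((\<lambda>y. \<psi>2 x y - t * \<phi>2 (x, y)) has_real_derivative \<psi>22 x y - t * \<phi>22 (x, y)) (at y)"
      using e[OF pU] by (intro DERIV_diff DERIV_cmult der) auto
    from interior_max_2d[OF oU pU Dle 1 2 3 4]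
    show "\<psi>1 x y - t * \<phi>1 (x, y) = 0" "\<psi>2 x y - t * \<phi>2 (x, y) = 0"
      "\<psi>11 x y - t * \<phi>11 (x, y) \<le> 0" "\<psi>22 x y - t * \<phi>22 (x, y) \<le> 0" by blast+
  qed
  have flow: "v1 x y * \<psi>1 x y + v2 x y * \<psi>2 x y = 0"
    by (simp add: v1_def v2_def \<psi>1_def \<psi>2_def algebra_simps)
  have "lam * \<psi> (x, y) = t * (lam * \<phi> (x, y))" using \<phi>K[OF p(1)] by (simp add: t_def xy)
  also have "\<dots> = t * (- (\<phi>11 (x, y) + \<phi>22 (x, y)) + A * (v1 x y * \<phi>1 (x, y) + v2 x y * \<phi>2 (x, y)))"
    using e[OF pU] by simp
  also have "\<dots> = - (t * \<phi>11 (x, y) + t * \<phi>22 (x, y)) + A * (v1 x y * (t * \<phi>1 (x, y)) + v2 x y * (t * \<phi>2 (x, y)))"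
    by (simp add: algebra_simps)
  also have "\<dots> = - (t * \<phi>11 (x, y) + t * \<phi>22 (x, y)) + A * (v1 x y * \<psi>1 x y + v2 x y * \<psi>2 x y)"
    using crit(1,2) by simp
  also have "\<dots> \<le> - (\<psi>11 x y + \<psi>22 x y)" unfolding flow using crit by simp
  finally have le: "lam * (d x y)\<^sup>2 \<le> - (\<psi>11 x y + \<psi>22 x y)" by (simp add: \<psi>_def d_def)
  define a where "a = sin (pi * x)"
  define b where "b = sin (pi * y)"
  have hab: "h (x, y) = a * b" by (simp add: h_def a_def b_def)
  have h1: "a * b \<le> 1" "1/2 < a * b"
  proof -
    have "\<bar>a * b\<bar> \<le> 1" unfolding abs_mult a_def b_def by (intro mult_le_one) auto
    then show "a * b \<le> 1" by simp
    show "1/2 < a * b" using pU by (simp add: U_def hab[symmetric])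
  qed
  have "- (\<psi>11 x y + \<psi>22 x y) = pi\<^sup>2 * (4 * d x y * (a * b) - 2 * ((cos (pi * x))\<^sup>2 * b\<^sup>2 + a\<^sup>2 * (cos (pi * y))\<^sup>2))"
    unfolding \<psi>11_def \<psi>22_def hab by (simp add: a_def b_def power_mult_distrib algebra_simps)
  also have "(cos (pi * x))\<^sup>2 * b\<^sup>2 + a\<^sup>2 * (cos (pi * y))\<^sup>2 = a\<^sup>2 + b\<^sup>2 - 2 * (a * b)\<^sup>2"
    unfolding cos_squared_eq a_def[symmetric] b_def[symmetric] by (simp add: power_mult_distrib algebra_simps)
  also have "pi\<^sup>2 * (4 * d x y * (a * b) - 2 * (a\<^sup>2 + b\<^sup>2 - 2 * (a * b)\<^sup>2))
     \<le> pi\<^sup>2 * (4 * (a * b) * (2 * d x y - 1/2))"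
  proof (rule mult_left_mono)
    have "0 \<le> (a - b)\<^sup>2" by simp
    then show "4 * d x y * (a * b) - 2 * (a\<^sup>2 + b\<^sup>2 - 2 * (a * b)\<^sup>2) \<le> 4 * (a * b) * (2 * d x y - 1/2)"
      unfolding d_def hab by (simp add: power2_eq_square algebra_simps)
  qed simp
  finally have fin: "lam * (d x y)\<^sup>2 \<le> pi\<^sup>2 * (4 * (a * b) * (2 * d x y - 1/2))" using le by simp
  have d: "0 < d x y" "d x y \<le> 1/2" using h1 by (auto simp: d_def hab)
  \<comment> \<open>The right-hand side changes sign at \<open>d x y = 1/4\<close>. Beyond this
    value it is at most \<open>2 * pi\<^sup>2\<close>, and division by
    \<open>(d x y)\<^sup>2 \<ge> 1/16\<close> gives \<open>32 * pi\<^sup>2\<close>.\<close>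
  show ?thesis
  proof (cases "d x y \<le> 1/4")
    case True
    then have "pi\<^sup>2 * (4 * (a * b) * (2 * d x y - 1/2)) \<le> 0"
      using h1 by (intro mult_nonneg_nonpos) auto
    then have "lam * (d x y)\<^sup>2 \<le> 0" using fin by (rule order_trans[rotated])
    then have "lam \<le> 0" using d by (simp add: mult_le_0_iff)
    also have "0 \<le> 32 * pi\<^sup>2" by simp
    finally show ?thesis .
  next
    case False
    have "pi\<^sup>2 * (4 * (a * b) * (2 * d x y - 1/2)) \<le> pi\<^sup>2 * (4 * 1 * (1/2))"
      using h1 d False by (intro mult_left_mono mult_mono) auto
    then have l: "lam * (d x y)\<^sup>2 \<le> 2 * pi\<^sup>2" using order_trans[OF fin] by simp
    have d2: "1/16 \<le> (d x y)\<^sup>2" using power_mono[of "1/4" "d x y" 2] False by (simp add: power2_eq_square)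
    show ?thesis
    proof (cases "lam \<le> 0")
      case True
      also have "0 \<le> 32 * pi\<^sup>2" by simp
      finally show ?thesis .
    next
      case False
      then have "lam * (1/16) \<le> lam * (d x y)\<^sup>2" using d2 by (intro mult_left_mono) auto
      then show ?thesis using l by simp
    qed
  qed
qed

section \<open>Lower bound\<close>

text \<open>\<open>\<sigma>\<close> is 1 or -1 according to the parity of \<open>k\<close>.
  Reflection about the line \<open>x = k\<close> maps the flow to itself. Shifting \<open>y\<close>
  by \<open>k + 1\<close> adapts the angles to this parity and also reverses the flow, which
  corrects the sign of the drift in \<open>jet\<close>.\<close>

lemma cellular_flow_reflection:
  fixes k :: int and s y :: real
  defines "\<sigma> \<equiv> cos (pi * real_of_int k)"
  shows "\<sigma> * v1 s y = v1 (real_of_int k + s) y" "\<sigma> * v2 s y = v2 (real_of_int k + s) y"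
    "\<sigma> * v1 s y = - v1 (real_of_int k - s) y" "\<sigma> * v2 s y = v2 (real_of_int k - s) y"
    "sin (pi * (y + real_of_int k + 1)) = - \<sigma> * sin (pi * y)" "cos (pi * (y + real_of_int k + 1)) = - \<sigma> * cos (pi * y)"
proof -
  have z: "sin (pi * real_of_int k) = 0" unfolding sin_zero_iff_int2 by (auto simp: mult.commute)
  have p: "sin (pi * (real_of_int k + s)) = \<sigma> * sin (pi * s)" "cos (pi * (real_of_int k + s)) = \<sigma> * cos (pi * s)"
    "sin (pi * (real_of_int k - s)) = - (\<sigma> * sin (pi * s))" "cos (pi * (real_of_int k - s)) = \<sigma> * cos (pi * s)" for s :: real
    using z by (simp_all add: \<sigma>_def distrib_left right_diff_distrib sin_add cos_add sin_diff cos_diff)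
  show "\<sigma> * v1 s y = v1 (real_of_int k + s) y" "\<sigma> * v2 s y = v2 (real_of_int k + s) y"
    "\<sigma> * v1 s y = - v1 (real_of_int k - s) y" "\<sigma> * v2 s y = v2 (real_of_int k - s) y"
    unfolding v1_def v2_def p by simp_all
  have e: "pi * (y + real_of_int k + 1) = pi * (real_of_int k + y) + pi" by (simp add: algebra_simps)
  show "sin (pi * (y + real_of_int k + 1)) = - \<sigma> * sin (pi * y)" "cos (pi * (y + real_of_int k + 1)) = - \<sigma> * cos (pi * y)"
    unfolding e by (simp_all add: p)
qed

lemma jet_drift:
  assumes "jet a u u1 u2 g"
  obtains u11 u22 where
    "\<And>s t. ((\<lambda>s. u s t) has_real_derivative u1 s t) (at s)"
    "\<And>s t. ((\<lambda>t. u s t) has_real_derivative u2 s t) (at t)"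
    "\<And>s t. ((\<lambda>s. u1 s t) has_real_derivative u11 s t) (at s)"
    "\<And>s t. ((\<lambda>t. u2 s t) has_real_derivative u22 s t) (at t)"
    "\<And>s t. g s t = u11 s t + u22 s t + a * (cos s * sin t * u2 s t - sin s * cos t * u1 s t)"
  using assms unfolding jet_def by blast

text \<open>The weight \<open>\<theta> = 1/2\<close> symmetrises \<open>\<phi>\<close> about the line \<open>x = k\<close>, and \<open>\<theta> = 1\<close> gives \<open>\<phi>\<close> itself.\<close>

lemma column_comparison:
  fixes n :: nat and k :: int and s y :: real
  assumes pe: "principal_eigenpair (2 * real n) A lam \<phi>"
    and jet: "jet (A / pi) u u1 u2 g"
    and u: "\<And>s t. \<bar>s\<bar> \<le> pi \<Longrightarrow> 0 \<le> u s t" and g: "\<And>s t. \<bar>s\<bar> \<le> pi \<Longrightarrow> g s t \<le> - 1/16"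
    and k: "\<bar>k\<bar> < int n" and \<theta>: "0 \<le> \<theta>" "\<theta> \<le> 1" and \<kappa>: "0 < \<kappa>"
    and \<phi>S: "\<And>p. p \<in> sq_closed (2 * real n) \<Longrightarrow> \<phi> p \<le> S"
    and small: "max 0 lam * S < \<kappa> * pi\<^sup>2 / 16"
    and m: "0 \<le> m" "\<And>y. \<bar>y\<bar> \<le> real n \<Longrightarrow> \<theta> * \<phi> (real_of_int k + 1, y) + (1 - \<theta>) * \<phi> (real_of_int k - 1, y) \<le> m"
      "\<And>y. \<bar>y\<bar> \<le> real n \<Longrightarrow> \<theta> * \<phi> (real_of_int k - 1, y) + (1 - \<theta>) * \<phi> (real_of_int k + 1, y) \<le> m"
    and sy: "\<bar>s\<bar> \<le> 1" "\<bar>y\<bar> \<le> real n"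
  shows "\<theta> * \<phi> (real_of_int k + s, y) + (1 - \<theta>) * \<phi> (real_of_int k - s, y) \<le> m + \<kappa> * u (pi * s) (pi * (y + real_of_int k + 1))"
proof -
  define L where "L = 2 * real n"
  obtain \<phi>1 \<phi>2 \<phi>11 \<phi>22 where cont: "continuous_on (sq_closed L) \<phi>"
    and bd0: "\<And>p. p \<in> sq_closed L - sq_open L \<Longrightarrow> \<phi> p = 0"
    and pos: "\<And>p. p \<in> sq_open L \<Longrightarrow> 0 < \<phi> p"
    and eq: "\<And>x y. (x, y) \<in> sq_open L \<Longrightarrow>
           ((\<lambda>t. \<phi> (t, y)) has_real_derivative \<phi>1 (x, y)) (at x) \<and>
           ((\<lambda>t. \<phi> (x, t)) has_real_derivative \<phi>2 (x, y)) (at y) \<and>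
           ((\<lambda>t. \<phi>1 (t, y)) has_real_derivative \<phi>11 (x, y)) (at x) \<and>
           ((\<lambda>t. \<phi>2 (x, t)) has_real_derivative \<phi>22 (x, y)) (at y) \<and>
           - (\<phi>11 (x, y) + \<phi>22 (x, y))
             + A * (v1 x y * \<phi>1 (x, y) + v2 x y * \<phi>2 (x, y))
           = lam * \<phi> (x, y)"
    using pe[folded L_def] unfolding principal_eigenpair_def by fast
  obtain u11 u22 where U:
    "\<And>s t. ((\<lambda>s. u s t) has_real_derivative u1 s t) (at s)"
    "\<And>s t. ((\<lambda>t. u s t) has_real_derivative u2 s t) (at t)"
    "\<And>s t. ((\<lambda>s. u1 s t) has_real_derivative u11 s t) (at s)"
    "\<And>s t. ((\<lambda>t. u2 s t) has_real_derivative u22 s t) (at t)"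
    "\<And>s t. g s t = u11 s t + u22 s t + A / pi * (cos s * sin t * u2 s t - sin s * cos t * u1 s t)"
    using jet_drift[OF jet] by blast
  have uc: "continuous_on UNIV (\<lambda>p. u (fst p) (snd p))" using jet by (simp add: jet_def)
  define \<tau> where "\<tau> y = pi * (y + real_of_int k + 1)" for y :: real
  define \<sigma> where "\<sigma> = cos (pi * real_of_int k)"
  note fl = cellular_flow_reflection[where k = k, folded \<sigma>_def]
  \<comment> \<open>\<open>D\<close> is a strict subsolution: \<open>\<kappa> * u\<close> has a
    defect of at least \<open>\<kappa> * pi\<^sup>2 / 16\<close>, which by \<open>small\<close>
    exceeds the source \<open>lam * \<phi>\<close>.\<close>
  define D where "D p = \<theta> * \<phi> (real_of_int k + fst p, snd p) + (1 - \<theta>) * \<phi> (real_of_int k - fst p, snd p) - m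
     - \<kappa> * u (pi * fst p) (\<tau> (snd p))" for p :: "real \<times> real"
  define K :: "(real \<times> real) set" where "K = {-1..1} \<times> {- real n..real n}"
  define V :: "(real \<times> real) set" where "V = {-1<..<1} \<times> {- real n<..<real n}"
  have k': "\<bar>of_int k\<bar> \<le> real n - 1"
    using k by linarith
  have in1: "(real_of_int k + s, y) \<in> sq_open L" "(real_of_int k - s, y) \<in> sq_open L" if "(s, y) \<in> V" for s y :: real
    using that k' unfolding V_def sq_open_def L_def by (auto simp: abs_less_iff)
  have in2: "(real_of_int k + s, y) \<in> sq_closed L" "(real_of_int k - s, y) \<in> sq_closed L" if "(s, y) \<in> K" for s y :: real
    using that k' unfolding K_def sq_closed_def L_def by (auto simp: abs_le_iff)
  have "D (s, y) \<le> 0"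
  proof (rule maximum_principle[where K = K and U = V
      and ?D1.0 = "\<lambda>s y. \<theta> * \<phi>1 (real_of_int k + s, y) - (1 - \<theta>) * \<phi>1 (real_of_int k - s, y) - \<kappa> * (pi * u1 (pi * s) (\<tau> y))"
      and ?D2.0 = "\<lambda>s y. \<theta> * \<phi>2 (real_of_int k + s, y) + (1 - \<theta>) * \<phi>2 (real_of_int k - s, y) - \<kappa> * (pi * u2 (pi * s) (\<tau> y))"
      and ?D11.0 = "\<lambda>s y. \<theta> * \<phi>11 (real_of_int k + s, y) + (1 - \<theta>) * \<phi>11 (real_of_int k - s, y) - \<kappa> * (pi\<^sup>2 * u11 (pi * s) (\<tau> y))"
      and ?D22.0 = "\<lambda>s y. \<theta> * \<phi>22 (real_of_int k + s, y) + (1 - \<theta>) * \<phi>22 (real_of_int k - s, y) - \<kappa> * (pi\<^sup>2 * u22 (pi * s) (\<tau> y))"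
      and ?b1.0 = "\<lambda>s y. - A * (\<sigma> * v1 s y)" and ?b2.0 = "\<lambda>s y. - A * (\<sigma> * v2 s y)"])
    show "compact K" unfolding K_def by (intro compact_Times) auto
    show "open V" unfolding V_def by (intro open_Times) auto
    show "V \<subseteq> K" by (auto simp: V_def K_def)
    show "(s, y) \<in> K" using sy by (auto simp: K_def abs_le_iff)
    show "continuous_on K D"
    proof -
      have 1: "continuous_on K (\<lambda>p. \<phi> (real_of_int k + fst p, snd p))"
        by (rule continuous_on_compose2[OF cont]) (use in2 in \<open>auto intro!: continuous_intros\<close>)
      have 2: "continuous_on K (\<lambda>p. \<phi> (real_of_int k - fst p, snd p))"
        by (rule continuous_on_compose2[OF cont]) (use in2 in \<open>auto intro!: continuous_intros\<close>)
      have 3: "continuous_on K (\<lambda>p. u (pi * fst p) (\<tau> (snd p)))"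
      proof -
        have "continuous_on K (\<lambda>p. (pi * fst p, \<tau> (snd p)))"
          unfolding \<tau>_def by (intro continuous_intros)
        from continuous_on_compose2[OF uc this] show ?thesis by simp
      qed
      show ?thesis unfolding D_def by (intro continuous_intros 1 2 3)
    qed
  next
    fix p assume "p \<in> K - V"
    then obtain s y where p: "p = (s, y)" "(s, y) \<in> K" "(s, y) \<notin> V" by (cases p) auto
    have s: "\<bar>s\<bar> \<le> 1" "\<bar>y\<bar> \<le> real n" using p by (auto simp: K_def abs_le_iff)
    then have "\<bar>pi * s\<bar> \<le> pi" by (simp add: abs_mult)
    then have u0: "0 \<le> \<kappa> * u (pi * s) (\<tau> y)" using u \<kappa> by simp
    consider "s = 1" | "s = -1" | "\<bar>y\<bar> = real n" using p s unfolding V_def by fastforce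
    then have "\<theta> * \<phi> (real_of_int k + s, y) + (1 - \<theta>) * \<phi> (real_of_int k - s, y) \<le> m"
    proof cases
      case 1 then show ?thesis using m(2)[OF s(2)] by simp
    next
      case 2 then show ?thesis using m(3)[OF s(2)] by simp
    next
      case 3
      have "\<phi> (real_of_int k + s, y) = 0" "\<phi> (real_of_int k - s, y) = 0"
        using in2[OF p(2)] 3 by (auto intro!: bd0 simp: sq_open_def L_def)
      then show ?thesis using m(1) by simp
    qed
    then show "D p \<le> 0" using u0 by (simp add: D_def p)
  next
    fix s y :: real assume V: "(s, y) \<in> V"
    note e1 = eq[OF in1(1)[OF V]] and e2 = eq[OF in1(2)[OF V]]
    have pl: "((\<lambda>s. real_of_int k + s) has_real_derivative 1) (at s)"
      and mi: "((\<lambda>s. real_of_int k - s) has_real_derivative -1) (at s)"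
      and pis: "((\<lambda>s. pi * s) has_real_derivative pi) (at s)"
      and ta: "(\<tau> has_real_derivative pi) (at y)"
      unfolding \<tau>_def by (auto intro!: derivative_eq_intros)
    have p1: "((\<lambda>s. \<phi> (real_of_int k + s, y)) has_real_derivative \<phi>1 (real_of_int k + s, y)) (at s)"
      and p11: "((\<lambda>s. \<phi>1 (real_of_int k + s, y)) has_real_derivative \<phi>11 (real_of_int k + s, y)) (at s)"
      using DERIV_chain2[OF _ pl, of "\<lambda>x. \<phi> (x, y)"] DERIV_chain2[OF _ pl, of "\<lambda>x. \<phi>1 (x, y)"] e1 by fastforce+
    have m1: "((\<lambda>s. \<phi> (real_of_int k - s, y)) has_real_derivative - \<phi>1 (real_of_int k - s, y)) (at s)"
      and m11: "((\<lambda>s. \<phi>1 (real_of_int k - s, y)) has_real_derivative - \<phi>11 (real_of_int k - s, y)) (at s)"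
      using DERIV_chain2[OF _ mi, of "\<lambda>x. \<phi> (x, y)"] DERIV_chain2[OF _ mi, of "\<lambda>x. \<phi>1 (x, y)"] e2 by fastforce+
    have w1: "((\<lambda>s. u (pi * s) (\<tau> y)) has_real_derivative pi * u1 (pi * s) (\<tau> y)) (at s)"
      and w11: "((\<lambda>s. u1 (pi * s) (\<tau> y)) has_real_derivative pi * u11 (pi * s) (\<tau> y)) (at s)"
      using DERIV_chain2[OF U(1) pis, of "\<tau> y"] DERIV_chain2[OF U(3) pis, of "\<tau> y"] by (simp_all add: mult.commute)
    have w2: "((\<lambda>y. u (pi * s) (\<tau> y)) has_real_derivative pi * u2 (pi * s) (\<tau> y)) (at y)"
      and w22: "((\<lambda>y. u2 (pi * s) (\<tau> y)) has_real_derivative pi * u22 (pi * s) (\<tau> y)) (at y)"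
      using DERIV_chain2[OF U(2) ta, of "pi * s"] DERIV_chain2[OF U(4) ta, of "pi * s"] by (simp_all add: mult.commute)
    show "((\<lambda>x. D (x, y)) has_real_derivative \<theta> * \<phi>1 (real_of_int k + s, y) - (1 - \<theta>) * \<phi>1 (real_of_int k - s, y) - \<kappa> * (pi * u1 (pi * s) (\<tau> y))) (at s)"
      unfolding D_def fst_conv snd_conv
      by (rule DERIV_cong[OF DERIV_diff[OF DERIV_diff[OF DERIV_add[OF DERIV_cmult[OF p1] DERIV_cmult[OF m1]] DERIV_const] DERIV_cmult[OF w1]]]) simp
    show "((\<lambda>y. D (s, y)) has_real_derivative \<theta> * \<phi>2 (real_of_int k + s, y) + (1 - \<theta>) * \<phi>2 (real_of_int k - s, y) - \<kappa> * (pi * u2 (pi * s) (\<tau> y))) (at y)"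
      unfolding D_def fst_conv snd_conv
      by (rule DERIV_cong[OF DERIV_diff[OF DERIV_diff[OF DERIV_add[OF DERIV_cmult DERIV_cmult] DERIV_const] DERIV_cmult[OF w2]]])
         (use e1 e2 in auto)
    show "((\<lambda>s. \<theta> * \<phi>1 (real_of_int k + s, y) - (1 - \<theta>) * \<phi>1 (real_of_int k - s, y) - \<kappa> * (pi * u1 (pi * s) (\<tau> y))) has_real_derivative
        \<theta> * \<phi>11 (real_of_int k + s, y) + (1 - \<theta>) * \<phi>11 (real_of_int k - s, y) - \<kappa> * (pi\<^sup>2 * u11 (pi * s) (\<tau> y))) (at s)"
      by (rule DERIV_cong[OF DERIV_diff[OF DERIV_diff[OF DERIV_cmult[OF p11] DERIV_cmult[OF m11]] DERIV_cmult[OF DERIV_cmult[OF w11]]]])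
         (simp add: power2_eq_square)
    show "((\<lambda>y. \<theta> * \<phi>2 (real_of_int k + s, y) + (1 - \<theta>) * \<phi>2 (real_of_int k - s, y) - \<kappa> * (pi * u2 (pi * s) (\<tau> y))) has_real_derivative
        \<theta> * \<phi>22 (real_of_int k + s, y) + (1 - \<theta>) * \<phi>22 (real_of_int k - s, y) - \<kappa> * (pi\<^sup>2 * u22 (pi * s) (\<tau> y))) (at y)"
      by (rule DERIV_cong[OF DERIV_diff[OF DERIV_add[OF DERIV_cmult DERIV_cmult] DERIV_cmult[OF DERIV_cmult[OF w22]]]])
         (use e1 e2 in \<open>auto simp: power2_eq_square\<close>)
    define p where "p = (real_of_int k + s, y)"
    define q where "q = (real_of_int k - s, y)"
    have \<tau>y: "sin (\<tau> y) = - \<sigma> * sin (pi * y)" "cos (\<tau> y) = - \<sigma> * cos (pi * y)"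
      unfolding \<tau>_def by (rule fl)+
    \<comment> \<open>Back in the variables \<open>x\<close>, \<open>y\<close> the Laplacian carries
      \<open>pi\<^sup>2\<close> and the drift \<open>pi\<^sup>2 * (A / pi) = A * pi\<close>; the
      factor \<open>- \<sigma>\<close> from the shift gives the drift its required sign.\<close>
    have G: "pi\<^sup>2 * g (pi * s) (\<tau> y) = pi\<^sup>2 * u11 (pi * s) (\<tau> y) + pi\<^sup>2 * u22 (pi * s) (\<tau> y)
        - A * (\<sigma> * v1 s y * (pi * u1 (pi * s) (\<tau> y)) + \<sigma> * v2 s y * (pi * u2 (pi * s) (\<tau> y)))"
      unfolding U(5) \<tau>y v1_def v2_def by (simp add: power2_eq_square algebra_simps)
    have E1: "\<phi>11 p + \<phi>22 p - A * (\<sigma> * v1 s y * \<phi>1 p + \<sigma> * v2 s y * \<phi>2 p) = - lam * \<phi> p"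
      using e1 unfolding fl(1,2) p_def by (simp add: algebra_simps)
    have E2: "\<phi>11 q + \<phi>22 q - A * (\<sigma> * v1 s y * - \<phi>1 q + \<sigma> * v2 s y * \<phi>2 q) = - lam * \<phi> q"
      using e2 unfolding fl(3,4) q_def by (simp add: algebra_simps)
    \<comment> \<open>The sign of \<open>lam\<close> is open at this point, hence
      \<open>max 0 lam\<close>.\<close>
    have lb: "- (max 0 lam * S) \<le> - lam * \<phi> r" if "r \<in> sq_open L" for r
    proof -
      have "lam * \<phi> r \<le> max 0 lam * \<phi> r" using pos[OF that] by (intro mult_right_mono) auto
      also have "\<dots> \<le> max 0 lam * S" using \<phi>S[of r] that
        by (intro mult_left_mono) (auto simp: sq_open_def sq_closed_def L_def)
      finally show ?thesis by simp
    qed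
    have "\<theta> * - (max 0 lam * S) + (1 - \<theta>) * - (max 0 lam * S) \<le> \<theta> * (- lam * \<phi> p) + (1 - \<theta>) * (- lam * \<phi> q)"
      using \<theta> in1[OF V] unfolding p_def q_def by (intro add_mono mult_left_mono lb) auto
    then have A1: "- (max 0 lam * S) \<le> \<theta> * (- lam * \<phi> p) + (1 - \<theta>) * (- lam * \<phi> q)"
      by (simp add: algebra_simps)
    have "\<bar>pi * s\<bar> \<le> pi" using V by (auto simp: V_def abs_mult)
    then have "\<kappa> * pi\<^sup>2 * g (pi * s) (\<tau> y) \<le> \<kappa> * pi\<^sup>2 * (- 1/16)"
      using \<kappa> by (intro mult_left_mono g) auto
    then have A2: "\<kappa> * pi\<^sup>2 / 16 \<le> - \<kappa> * (pi\<^sup>2 * g (pi * s) (\<tau> y))" by simp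
    have "0 < \<theta> * (- lam * \<phi> p) + (1 - \<theta>) * (- lam * \<phi> q) - \<kappa> * (pi\<^sup>2 * g (pi * s) (\<tau> y))"
      using A1 A2 small by simp
    also have "\<dots> = (\<theta> * \<phi>11 p + (1 - \<theta>) * \<phi>11 q - \<kappa> * (pi\<^sup>2 * u11 (pi * s) (\<tau> y)))
        + (\<theta> * \<phi>22 p + (1 - \<theta>) * \<phi>22 q - \<kappa> * (pi\<^sup>2 * u22 (pi * s) (\<tau> y)))
        + - A * (\<sigma> * v1 s y) * (\<theta> * \<phi>1 p - (1 - \<theta>) * \<phi>1 q - \<kappa> * (pi * u1 (pi * s) (\<tau> y)))
        + - A * (\<sigma> * v2 s y) * (\<theta> * \<phi>2 p + (1 - \<theta>) * \<phi>2 q - \<kappa> * (pi * u2 (pi * s) (\<tau> y)))"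
      unfolding G E1[symmetric] E2[symmetric] by (simp add: algebra_simps)
    finally show "0 < \<theta> * \<phi>11 (real_of_int k + s, y) + (1 - \<theta>) * \<phi>11 (real_of_int k - s, y) - \<kappa> * (pi\<^sup>2 * u11 (pi * s) (\<tau> y))
        + (\<theta> * \<phi>22 (real_of_int k + s, y) + (1 - \<theta>) * \<phi>22 (real_of_int k - s, y) - \<kappa> * (pi\<^sup>2 * u22 (pi * s) (\<tau> y)))
        + - A * (\<sigma> * v1 s y) * (\<theta> * \<phi>1 (real_of_int k + s, y) - (1 - \<theta>) * \<phi>1 (real_of_int k - s, y) - \<kappa> * (pi * u1 (pi * s) (\<tau> y)))
        + - A * (\<sigma> * v2 s y) * (\<theta> * \<phi>2 (real_of_int k + s, y) + (1 - \<theta>) * \<phi>2 (real_of_int k - s, y) - \<kappa> * (pi * u2 (pi * s) (\<tau> y)))"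
      unfolding p_def q_def .
  qed
  then show ?thesis by (simp add: D_def \<tau>_def)
qed

section \<open>From line to line: maxima on the separatrices \<open>x = k\<close>\<close>

lemma discrete_maximum_principle:
  fixes N :: "int \<Rightarrow> real" and n :: int
  assumes n: "0 < n" and bd: "N (- n) \<le> 0" "N n \<le> 0"
    and sub: "\<And>k. \<bar>k\<bar> < n \<Longrightarrow> N k \<le> (N (k - 1) + N (k + 1)) / 2"
    and k: "\<bar>k\<bar> \<le> n"
  shows "N k \<le> 0"
proof (rule ccontr)
  assume "\<not> N k \<le> 0"
  define T where "T = Max (N ` {-n..n})"
  have le: "N j \<le> T" if "j \<in> {-n..n}" for j unfolding T_def using that by (intro Max_ge) auto
  have kn: "k \<in> {-n..n}" using k by auto
  have T: "0 < T" using le[OF kn] \<open>\<not> N k \<le> 0\<close> by simp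
  define J where "J = {j \<in> {-n..n}. N j = T}"
  have "T \<in> N ` {-n..n}" unfolding T_def using kn by (intro Max_in) auto
  then have "J \<noteq> {}" by (auto simp: J_def)
  moreover have "finite J" unfolding J_def by (rule finite_subset[of _ "{-n..n}"]) auto
  ultimately have J: "finite J" "J \<noteq> {}" by auto
  \<comment> \<open>At the leftmost maximiser the value to the left is strictly smaller, which
    contradicts the mean value inequality.\<close>
  define j where "j = Min J"
  have j: "j \<in> J" unfolding j_def using J by (rule Min_in)
  have jn: "\<bar>j\<bar> < n"
  proof -
    have "j \<noteq> n" "j \<noteq> - n" using j bd T by (auto simp: J_def)
    then show ?thesis using j by (auto simp: J_def)
  qed
  have "j - 1 \<notin> J" using Min_le[OF J(1), of "j - 1"] j_def by fastforce
  moreover have "j - 1 \<in> {-n..n}" using jn by auto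
  ultimately have "N (j - 1) < T" using le[of "j - 1"] by (simp add: J_def less_le)
  moreover have "j + 1 \<in> {-n..n}" using jn by auto
  then have "N (j + 1) \<le> T" by (rule le)
  ultimately show False using sub[OF jn] j by (simp add: J_def)
qed

text \<open>With \<open>S\<close> the maximum of \<open>\<phi>\<close>, a smaller \<open>lam\<close>
  would allow \<open>\<kappa> = S / (2 * W)\<close> in the column comparison. This leads to
  \<open>\<phi> \<le> \<kappa> * W = S / 2\<close> on the whole square, against the choice of
  \<open>S\<close>.\<close>

lemma eigenvalue_lower_bound:
  fixes n :: nat
  assumes pe: "principal_eigenpair (2 * real n) A lam \<phi>" and n: "1 \<le> n"
    and jet: "jet (A / pi) u u1 u2 g"
    and u: "\<And>s t. \<bar>s\<bar> \<le> pi \<Longrightarrow> 0 \<le> u s t \<and> u s t \<le> C \<and> g s t \<le> - 1/16"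
    and u0: "\<And>t. u 0 t \<le> U" and U: "0 \<le> U"
    and W: "U * (real n)\<^sup>2 + C \<le> W" "0 < W"
  shows "pi\<^sup>2 / (32 * W) \<le> lam"
proof (rule ccontr)
  assume "\<not> pi\<^sup>2 / (32 * W) \<le> lam"
  then have lam: "lam < pi\<^sup>2 / (32 * W)" by simp
  define Q where "Q = sq_closed (2 * real n)"
  have cont: "continuous_on Q \<phi>"
    and bd0: "\<And>p. p \<in> Q - sq_open (2 * real n) \<Longrightarrow> \<phi> p = 0"
    and pos: "\<And>p. p \<in> sq_open (2 * real n) \<Longrightarrow> 0 < \<phi> p"
    using pe unfolding principal_eigenpair_def Q_def by blast+
  have Q_eq: "Q = {- real n..real n} \<times> {- real n..real n}"
    by (auto simp: Q_def sq_closed_def abs_le_iff)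
  have cQ: "compact Q" unfolding Q_eq by (intro compact_Times) auto
  have z: "(0, 0) \<in> Q" "(0, 0) \<in> sq_open (2 * real n)" using n by (auto simp: Q_eq sq_open_def)
  obtain p0 where p0: "p0 \<in> Q" "\<And>p. p \<in> Q \<Longrightarrow> \<phi> p \<le> \<phi> p0"
    using continuous_attains_sup[OF cQ _ cont] z by blast
  define S where "S = \<phi> p0"
  have S: "0 < S" using p0(2)[OF z(1)] pos[OF z(2)] by (simp add: S_def)
  define \<kappa> where "\<kappa> = S / (2 * W)"
  have \<kappa>: "0 < \<kappa>" using S W by (simp add: \<kappa>_def)
  have small: "max 0 lam * S < \<kappa> * pi\<^sup>2 / 16"
  proof -
    have "max 0 lam < pi\<^sup>2 / (32 * W)" using lam W by simp
    then have "max 0 lam * S < pi\<^sup>2 / (32 * W) * S" using S by (rule mult_strict_right_mono)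
    then show ?thesis by (simp add: \<kappa>_def field_simps)
  qed
  have \<phi>0: "0 \<le> \<phi> p" if "p \<in> Q" for p using bd0[of p] pos[of p] that by fastforce
  have up: "0 \<le> u s t" and gn: "g s t \<le> - 1/16" if "\<bar>s\<bar> \<le> pi" for s t using u[OF that] by blast+
  have comp: "\<theta> * \<phi> (real_of_int k + s, y) + (1 - \<theta>) * \<phi> (real_of_int k - s, y)
      \<le> m + \<kappa> * u (pi * s) (pi * (y + real_of_int k + 1))"
    if "\<bar>k\<bar> < int n" "0 \<le> \<theta>" "\<theta> \<le> 1" "0 \<le> m"
      "\<And>y. \<bar>y\<bar> \<le> real n \<Longrightarrow> \<theta> * \<phi> (real_of_int k + 1, y) + (1 - \<theta>) * \<phi> (real_of_int k - 1, y) \<le> m"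
      "\<And>y. \<bar>y\<bar> \<le> real n \<Longrightarrow> \<theta> * \<phi> (real_of_int k - 1, y) + (1 - \<theta>) * \<phi> (real_of_int k + 1, y) \<le> m"
      "\<bar>s\<bar> \<le> 1" "\<bar>y\<bar> \<le> real n" for k \<theta> m s y
    by (rule column_comparison[OF pe jet up gn that(1-3) \<kappa> _ small that(4-8)])
       (auto simp: S_def Q_def intro: p0(2)[unfolded Q_def])
  have "\<exists>y. \<bar>y\<bar> \<le> real n \<and> (\<forall>y'. \<bar>y'\<bar> \<le> real n \<longrightarrow> \<phi> (real_of_int k, y') \<le> \<phi> (real_of_int k, y))"
    if "\<bar>k\<bar> \<le> int n" for k
  proof -
    have k: "real_of_int k \<in> {- real n..real n}" using that by (auto simp: abs_le_iff)
    have "continuous_on {- real n..real n} (\<lambda>y. \<phi> (real_of_int k, y))"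
      by (rule continuous_on_compose2[OF cont]) (use k in \<open>auto simp: Q_eq intro!: continuous_intros\<close>)
    then obtain y where "y \<in> {- real n..real n}" "\<forall>y'\<in>{- real n..real n}. \<phi> (real_of_int k, y') \<le> \<phi> (real_of_int k, y)"
      using continuous_attains_sup[of "{- real n..real n}" "\<lambda>y. \<phi> (real_of_int k, y)"] by auto
    then show ?thesis by (intro exI[of _ y]) (auto simp: abs_le_iff)
  qed
  then obtain Y where Y: "\<And>k. \<bar>k\<bar> \<le> int n \<Longrightarrow> \<bar>Y k\<bar> \<le> real n"
    "\<And>k y. \<bar>k\<bar> \<le> int n \<Longrightarrow> \<bar>y\<bar> \<le> real n \<Longrightarrow> \<phi> (real_of_int k, y) \<le> \<phi> (real_of_int k, Y k)"
    by metis
  define M where "M k = \<phi> (real_of_int k, Y k)" for k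
  have M0: "0 \<le> M k" if "\<bar>k\<bar> \<le> int n" for k
    unfolding M_def using Y(1)[OF that] that by (intro \<phi>0) (auto simp: Q_eq abs_le_iff)
  \<comment> \<open>With \<open>\<theta> = 1/2\<close> and \<open>s = 0\<close>: on both outer lines
    the symmetrised function is at most the mean of the neighbouring maxima, and on the middle line
    the barrier is at most \<open>U\<close>.\<close>
  have step: "M k \<le> (M (k - 1) + M (k + 1)) / 2 + \<kappa> * U" if k: "\<bar>k\<bar> < int n" for k
  proof -
    have b: "\<bar>k - 1\<bar> \<le> int n" "\<bar>k + 1\<bar> \<le> int n" "\<bar>k\<bar> \<le> int n" using k by auto
    have m: "1/2 * \<phi> (real_of_int k + 1, y) + (1 - 1/2) * \<phi> (real_of_int k - 1, y) \<le> (M (k - 1) + M (k + 1)) / 2"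
      "1/2 * \<phi> (real_of_int k - 1, y) + (1 - 1/2) * \<phi> (real_of_int k + 1, y) \<le> (M (k - 1) + M (k + 1)) / 2" if "\<bar>y\<bar> \<le> real n" for y
      using Y(2)[OF b(1) that] Y(2)[OF b(2) that] by (simp_all add: M_def)
    have "0 \<le> (M (k - 1) + M (k + 1)) / 2" using M0[OF b(1)] M0[OF b(2)] by simp
    from comp[OF k, of "1/2", OF _ _ this m, of 0 "Y k"] Y(1)[OF b(3)]
    have "M k \<le> (M (k - 1) + M (k + 1)) / 2 + \<kappa> * u 0 (pi * (Y k + real_of_int k + 1))"
      by (simp add: M_def)
    moreover have "\<kappa> * u 0 (pi * (Y k + real_of_int k + 1)) \<le> \<kappa> * U" using \<kappa> u0 by simp
    ultimately show ?thesis by linarith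
  qed
  have Mb: "M k \<le> \<kappa> * U * (real n)\<^sup>2" if k: "\<bar>k\<bar> \<le> int n" for k
  proof -
    \<comment> \<open>The parabola \<open>n\<^sup>2 - k\<^sup>2\<close> exceeds the mean of its
      neighbours by exactly 1, which cancels the error \<open>\<kappa> * U\<close> of each step, and
      it vanishes at both ends.\<close>
    define N where "N k = M k - \<kappa> * U * ((real n)\<^sup>2 - (real_of_int k)\<^sup>2)" for k
    have "N k \<le> 0"
    proof (rule discrete_maximum_principle[OF _ _ _ _ k])
      show "0 < int n" using n by simp
      have "M (- int n) = 0" "M (int n) = 0"
        using Y(1)[of "- int n"] Y(1)[of "int n"] unfolding M_def
        by (auto intro!: bd0 simp: Q_eq sq_open_def abs_le_iff)
      then show "N (- int n) \<le> 0" "N (int n) \<le> 0" by (simp_all add: N_def)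
      fix k :: int assume "\<bar>k\<bar> < int n"
      from step[OF this] show "N k \<le> (N (k - 1) + N (k + 1)) / 2"
        by (simp add: N_def power2_eq_square field_simps)
    qed
    moreover have "0 \<le> \<kappa> * U * (real_of_int k)\<^sup>2" using \<kappa> U by simp
    ultimately show ?thesis by (simp add: N_def algebra_simps)
  qed
  have "\<phi> p \<le> \<kappa> * W" if p: "p \<in> Q" for p
  proof (cases "\<bar>fst p\<bar> = real n")
    case True
    then have "\<phi> p = 0" using p by (intro bd0) (auto simp: sq_open_def)
    then show ?thesis using \<kappa> W by simp
  next
    case False
    define x where "x = fst p"
    define y where "y = snd p"
    have xy: "\<bar>x\<bar> < real n" "\<bar>y\<bar> \<le> real n" using p False unfolding x_def y_def Q_eq by (auto simp: abs_le_iff)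
    \<comment> \<open>Rounding towards zero keeps \<open>\<bar>k\<bar> < n\<close>, so that the
      lines \<open>k - 1\<close> and \<open>k + 1\<close> still lie in the square.\<close>
    define k where "k = (if 0 \<le> x then \<lfloor>x\<rfloor> else \<lceil>x\<rceil>)"
    have k: "\<bar>k\<bar> < int n" "\<bar>x - real_of_int k\<bar> \<le> 1" using xy unfolding k_def by (auto split: if_splits; linarith)+
    have b: "\<bar>k - 1\<bar> \<le> int n" "\<bar>k + 1\<bar> \<le> int n" using k by auto
    have m: "1 * \<phi> (real_of_int k + 1, y) + (1 - 1) * \<phi> (real_of_int k - 1, y) \<le> \<kappa> * U * (real n)\<^sup>2"
      "1 * \<phi> (real_of_int k - 1, y) + (1 - 1) * \<phi> (real_of_int k + 1, y) \<le> \<kappa> * U * (real n)\<^sup>2" if "\<bar>y\<bar> \<le> real n" for y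
      using Y(2)[OF b(1) that] Y(2)[OF b(2) that] Mb[OF b(1)] Mb[OF b(2)] by (simp_all add: M_def)
    have "0 \<le> \<kappa> * U * (real n)\<^sup>2" using \<kappa> U by simp
    from comp[OF k(1), of 1, OF _ _ this m k(2) xy(2)]
    have "\<phi> (x, y) \<le> \<kappa> * U * (real n)\<^sup>2 + \<kappa> * u (pi * (x - real_of_int k)) (pi * (y + real_of_int k + 1))" by simp
    also have "\<dots> \<le> \<kappa> * U * (real n)\<^sup>2 + \<kappa> * C"
    proof -
      have "\<bar>pi * (x - real_of_int k)\<bar> \<le> pi" using k(2) by (simp add: abs_mult)
      then show ?thesis using u \<kappa> by simp
    qed
    also have "\<dots> = \<kappa> * (U * (real n)\<^sup>2 + C)" by (simp add: algebra_simps)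
    also have "\<dots> \<le> \<kappa> * W" using W \<kappa> by (intro mult_left_mono) auto
    finally show ?thesis by (simp add: x_def y_def)
  qed
  from this[OF p0(1)] show False using S W by (simp add: S_def[symmetric] \<kappa>_def)
qed

section \<open>Choice of the constants and conclusion\<close>

theorem theorem1p1:
  fixes L :: "real \<Rightarrow> nat"
  assumes L_even: "\<forall>A>0. even (L A) \<and> L A \<ge> 2"
    and L_growth: "Liminf at_top
        (\<lambda>A. ereal (sqrt A / ((real (L A))\<^sup>2 * ln A * ln (real (L A))))) > 0"
  shows "\<exists>lam0 lam1 :: real. 0 < lam0 \<and> lam0 \<le> lam1 \<and>
     (\<forall>\<^sub>F A in at_top. \<forall>lam \<phi>.
        principal_eigenpair (real (L A)) A lam \<phi> \<longrightarrow> lam0 \<le> lam \<and> lam \<le> lam1)"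
proof -
  obtain c where "ereal 0 < ereal c"
      "ereal c < Liminf at_top (\<lambda>A. ereal (sqrt A / ((real (L A))\<^sup>2 * ln A * ln (real (L A)))))"
    using ereal_dense2[OF L_growth] by (auto simp: zero_ereal_def)
  then have c: "0 < c" and growth:
      "\<forall>\<^sub>F A in at_top. c < sqrt A / ((real (L A))\<^sup>2 * ln A * ln (real (L A)))"
    using less_LiminfD by fastforce+
  obtain C a0 :: real where C: "0 < C" and barrier:
    "\<And>a. a0 \<le> a \<Longrightarrow> \<exists>u u1 u2 g. jet a u u1 u2 g \<and>
       (\<forall>s t. \<bar>s\<bar> \<le> pi \<longrightarrow> 0 \<le> u s t \<and> u s t \<le> C \<and> g s t \<le> - 1/16 \<and>
          (s = 0 \<longrightarrow> u s t \<le> C * (ln a / sqrt a)))"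
    using cell_barrier by blast
  \<comment> \<open>The first summand bounds \<open>U * (real n)\<^sup>2\<close>: 4 comes from
    \<open>n = L A div 2\<close>, \<open>sqrt pi\<close> from \<open>a = A / pi\<close>,
    \<open>c\<close> from the growth condition and \<open>ln 2\<close> from
    \<open>2 \<le> L A\<close>.\<close>
  define W where "W = C * (sqrt pi / (4 * c * ln 2)) + C"
  have W: "0 < W" using C c by (simp add: W_def add_nonneg_pos)
  \<comment> \<open>The minimum secures \<open>lam0 \<le> lam1\<close> without appeal to the
    existence of an eigenpair.\<close>
  define l0 where "l0 = min (pi\<^sup>2 / (32 * W)) (32 * pi\<^sup>2)"
  have l0: "0 < l0" "l0 \<le> 32 * pi\<^sup>2" "l0 \<le> pi\<^sup>2 / (32 * W)" using W by (auto simp: l0_def)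
  have "\<forall>\<^sub>F A in at_top. \<forall>lam \<phi>. principal_eigenpair (real (L A)) A lam \<phi> \<longrightarrow> l0 \<le> lam \<and> lam \<le> 32 * pi\<^sup>2"
    using growth eventually_ge_at_top[of "max 4 (pi * max 4 a0)"]
  proof eventually_elim
    case (elim A)
    have "max 4 a0 \<le> A / pi" using elim(2) by (simp add: le_divide_eq mult.commute)
    then have A: "4 \<le> A" "4 \<le> A / pi" "a0 \<le> A / pi" using elim(2) by auto
    define n where "n = L A div 2"
    have "even (L A)" "2 \<le> L A" using L_even A by auto
    then have L: "L A = 2 * n" "1 \<le> n" unfolding n_def by auto
    obtain u u1 u2 g where jet: "jet (A / pi) u u1 u2 g" and u:
      "\<And>s t. \<bar>s\<bar> \<le> pi \<Longrightarrow> 0 \<le> u s t \<and> u s t \<le> C \<and> g s t \<le> - 1/16 \<and>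
          (s = 0 \<longrightarrow> u s t \<le> C * (ln (A / pi) / sqrt (A / pi)))"
      using barrier[OF A(3)] by blast
    define U where "U = C * (ln (A / pi) / sqrt (A / pi))"
    have "0 \<le> ln (A / pi)" by (rule ln_ge_zero) (use A(2) in linarith)
    then have U: "0 \<le> U" unfolding U_def using C A by (intro mult_nonneg_nonneg divide_nonneg_nonneg) auto
    have "U * (real n)\<^sup>2 \<le> C * (sqrt pi / (4 * c * ln 2))"
    proof -
      define l where "l = (real (L A))\<^sup>2"
      have l: "0 < l" "(real n)\<^sup>2 = l / 4" using L by (auto simp: l_def power_mult_distrib)
      have ln2: "ln 2 \<le> ln (real (L A))" "0 < ln A" using L A by auto
      have "0 < l * ln A * ln (real (L A))" using l ln2 less_le_trans[OF ln_gt_zero[of "2::real"] ln2(1)] by simp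
      then have "c * (l * ln A * ln (real (L A))) \<le> sqrt A"
        using elim(1) by (simp add: l_def[symmetric] less_divide_eq less_imp_le)
      moreover have "c * (l * ln A * ln 2) \<le> c * (l * ln A * ln (real (L A)))"
        using c l ln2 by (intro mult_left_mono) auto
      ultimately have "c * (l * ln A * ln 2) \<le> sqrt A" by (rule order_trans[rotated])
      then have k: "l * ln A \<le> sqrt A / (c * ln 2)" using c by (simp add: le_divide_eq algebra_simps)
      have "ln (A / pi) \<le> ln A" using A pi_gt3 by (simp add: ln_div)
      then have "ln (A / pi) / sqrt (A / pi) * (l / 4) \<le> ln A / sqrt (A / pi) * (l / 4)"
        using A l by (intro mult_right_mono divide_right_mono) auto
      also have "\<dots> = (l * ln A) * (sqrt pi / (4 * sqrt A))" by (simp add: real_sqrt_divide mult_ac)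
      also have "\<dots> \<le> sqrt A / (c * ln 2) * (sqrt pi / (4 * sqrt A))"
        using k A by (intro mult_right_mono) auto
      also have "\<dots> = sqrt pi / (4 * c * ln 2)" using A by (simp add: field_simps)
      finally have "C * (ln (A / pi) / sqrt (A / pi) * (l / 4)) \<le> C * (sqrt pi / (4 * c * ln 2))"
        using C by (intro mult_left_mono) auto
      then show ?thesis by (simp add: U_def l)
    qed
    then have UW: "U * (real n)\<^sup>2 + C \<le> W" by (simp add: W_def)
    show ?case
    proof (intro allI impI conjI)
      fix lam \<phi> assume pe: "principal_eigenpair (real (L A)) A lam \<phi>"
      then have pe': "principal_eigenpair (2 * real n) A lam \<phi>" by (simp add: L)
      have "pi\<^sup>2 / (32 * W) \<le> lam"
      proof (rule eigenvalue_lower_bound[OF pe' L(2) jet _ _ U UW W])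
        show "u 0 t \<le> U" for t using u[of 0 t] by (simp add: U_def)
      qed (use u in blast)
      then show "l0 \<le> lam" using l0 by linarith
      show "lam \<le> 32 * pi\<^sup>2" by (rule eigenvalue_upper_bound[OF pe]) (use L in simp)
    qed
  qed
  with l0 show ?thesis by blast
qed

end
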